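(* Define integers $L_n$ for $n\ge 1$ by $L_1=0$, $L_2=1$, and $L_n=2q_n(L_{n-1}+1)$ for $n\ge3$, where $q_n=4n^2\lceil\log_2 n\rceil$. For every $n$-vertex graph $G$, every target vertex $v_\ast\in V(G)$, and every $\omega\in\mathbb R_{\ge0}^{V(G)}$, $$t(G,v_\ast,\omega)\le L_n .$$
   Context: All graphs are finite and simple, with nonempty vertex set, and are not assumed connected. Let $G=(V,E)$ be a graph. A nonempty set $S\subseteq V$ is called connected if the induced subgraph $G[S]$ is connected. For such $S$, the averaging operator $A_S\in\mathbb R^{V\times V}$ is defined by $(A_Sz)_v=|S|^{-1}\sum_{u\in S}z_u$ if $v\in S$ and $(A_Sz)_v=z_v$ if $v\notin S$. A strategy is a finite (possibly empty) sequence $\sigma=(S_1,\ldots,S_k)$ of nonempty connected sets, listed in chronological order; its length is $k$ and its operator is $A_\sigma=A_{S_k}\cdots A_{S_1}$ (the identity if $k=0$). Given initial weights $\omega$ and a target $v_\ast$, a strategy $\sigma$ is optimal if $(A_\sigma\omega)_{v_\ast}$ equals the supremum of $(A_\tau\omega)_{v_\ast}$ over all strategies $\tau$. $t(G,v_\ast,\omega)$ denotes the minimum length of an optimal strategy, with $t(G,v_\ast,\omega)=+\infty$ if the supremum is not attained. *)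

theory Defs
  imports Complex_Main "HOL-Library.Extended_Nat" "Graph_Theory.Graph_Theory"
begin

text \<open>
  A finite simple graph is a loop-free symmetric digraph without parallel arcs, i.e. the locale
  predicate \<open>graph\<close>. A vector in \<open>\<real>\<^sup>V\<close> is a function on the ambient vertex type, of
  which only the values on \<open>verts G\<close> matter. The constants \<open>graph\<close> and \<open>connected\<close> are
  qualified because \<open>Map\<close> and the topology theories use the same base names.
\<close>

definition connected_set :: "('v, 'e) pre_digraph \<Rightarrow> 'v set \<Rightarrow> bool" where
  "connected_set G S \<longleftrightarrow>
     S \<noteq> {} \<and> S \<subseteq> verts G \<and> Digraph_Component.connected (induce_subgraph G S)"

definition avg_op :: "'v set \<Rightarrow> ('v \<Rightarrow> real) \<Rightarrow> 'v \<Rightarrow> real" where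
  "avg_op S z v = (if v \<in> S then (\<Sum>u\<in>S. z u) / real (card S) else z v)"

definition strategy :: "('v, 'e) pre_digraph \<Rightarrow> 'v set list \<Rightarrow> bool" where
  "strategy G \<sigma> \<longleftrightarrow> (\<forall>S\<in>set \<sigma>. connected_set G S)"

text \<open>\<open>fold\<close> applies the head of the list, i.e. the chronologically first set, first.\<close>

definition strategy_op :: "'v set list \<Rightarrow> ('v \<Rightarrow> real) \<Rightarrow> 'v \<Rightarrow> real" where
  "strategy_op \<sigma> = fold avg_op \<sigma>"

text \<open>
  For finite \<open>G\<close> and a target in \<open>verts G\<close> the supremum below is over a nonempty set that is
  bounded above (lemma \<open>bdd_above_strategy_values\<close>), so the real \<open>SUP\<close> is the genuine supremum.
\<close>

definition optimal_strategy ::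
    "('v, 'e) pre_digraph \<Rightarrow> 'v \<Rightarrow> ('v \<Rightarrow> real) \<Rightarrow> 'v set list \<Rightarrow> bool" where
  "optimal_strategy G v \<omega> \<sigma> \<longleftrightarrow>
     strategy G \<sigma> \<and> strategy_op \<sigma> \<omega> v = (SUP \<tau>\<in>{\<tau>. strategy G \<tau>}. strategy_op \<tau> \<omega> v)"

text \<open>In \<open>enat\<close> the infimum of the empty set is \<open>\<infinity>\<close>: the case of a supremum not attained.\<close>

definition opt_length :: "('v, 'e) pre_digraph \<Rightarrow> 'v \<Rightarrow> ('v \<Rightarrow> real) \<Rightarrow> enat" where
  "opt_length G v \<omega> = (INF \<sigma>\<in>{\<sigma>. optimal_strategy G v \<omega> \<sigma>}. enat (length \<sigma>))"

definition q_seq :: "nat \<Rightarrow> nat" where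
  "q_seq n = 4 * n\<^sup>2 * nat \<lceil>log 2 (real n)\<rceil>"

text \<open>The value at \<open>0\<close> is a dummy: the sequence starts at index \<open>1\<close>.\<close>

fun L_seq :: "nat \<Rightarrow> nat" where
  "L_seq 0 = 0"
| "L_seq (Suc 0) = 0"
| "L_seq (Suc (Suc 0)) = 1"
| "L_seq (Suc n) = 2 * q_seq (Suc n) * (L_seq n + 1)"

lemma L_seq_1: "L_seq 1 = 0"
  by simp

lemma L_seq_2: "L_seq 2 = 1"
  by (simp add: numeral_2_eq_2)

lemma L_seq_rec:
  assumes "n \<ge> 3"
  shows "L_seq n = 2 * q_seq n * (L_seq (n - 1) + 1)"
proof -
  obtain k where "n = Suc (Suc (Suc k))"
    using assms by (metis Suc_le_D numeral_3_eq_3 Suc_le_mono)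
  then show ?thesis
    by simp
qed

lemma strategy_op_le:
  assumes "strategy G \<sigma>" and "\<And>u. u \<in> verts G \<Longrightarrow> \<omega> u \<le> M" and "finite (verts G)"
    and "v \<in> verts G"
  shows "strategy_op \<sigma> \<omega> v \<le> M"
  using assms(1,2)
proof (induction \<sigma> arbitrary: \<omega>)
  case Nil
  then show ?case
    using assms(4) by (simp add: strategy_op_def)
next
  case (Cons S \<sigma>)
  have S: "S \<noteq> {}" "S \<subseteq> verts G" "strategy G \<sigma>"
    using Cons.prems(1) by (auto simp: strategy_def connected_set_def)
  then have "finite S"
    using assms(3) finite_subset by blast
  with S have pos: "real (card S) > 0"
    by (simp add: card_gt_0_iff)
  have "(\<Sum>u\<in>S. \<omega> u) \<le> real (card S) * M"
    using S Cons.prems(2) by (intro sum_bounded_above) auto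
  then have "(\<Sum>u\<in>S. \<omega> u) / real (card S) \<le> M"
    using pos by (simp add: divide_le_eq mult.commute)
  then have "avg_op S \<omega> u \<le> M" if "u \<in> verts G" for u
    using that Cons.prems(2) by (simp add: avg_op_def)
  then show ?case
    using Cons.IH[OF S(3), of "avg_op S \<omega>"] by (simp add: strategy_op_def)
qed

lemma bdd_above_strategy_values:
  assumes "finite (verts G)" and "v \<in> verts G"
  shows "bdd_above ((\<lambda>\<tau>. strategy_op \<tau> \<omega> v) ` {\<tau>. strategy G \<tau>})"
proof (rule bdd_aboveI2)
  show "strategy_op \<tau> \<omega> v \<le> Max (\<omega> ` verts G)" if "\<tau> \<in> {\<tau>. strategy G \<tau>}" for \<tau>
    using that assms by (intro strategy_op_le[of G]) auto
qed

end

theory Submission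
  imports Defs "HOL-Analysis.Convex"
begin

text \<open>
  Averaging operators are self-adjoint, which suggests to bound the bilinear values \<open>x \<cdot> A\<^sub>\<sigma> z\<close>
  for all vectors \<open>x\<close> and \<open>z\<close>, rather than the values at one target. The claim, proved by
  induction on the number \<open>n\<close> of vertices in \<open>short_strategies_L_seq\<close>, is that for all \<open>x\<close>, \<open>z\<close>
  and \<open>\<sigma>\<close> some strategy of length at most \<open>L\<^sub>n\<close> has at least the value of \<open>\<sigma>\<close>. In this generality
  a bound also applies to each segment of a longer strategy: the later moves are transferred to
  \<open>x\<close> and the earlier ones to \<open>z\<close>. For the indicator \<open>x\<close> of the target, the claim says that only
  the finitely many strategies of length at most \<open>L\<^sub>n\<close> compete, so the supremum is attained by
  one of them.

  A list of moves that leaves some cut of the vertex set uncrossed acts separately on the two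
  sides. By induction it can be replaced by at most \<open>L\<^sub>a + L\<^sub>b\<close> moves, where \<open>a + b = n\<close>, and this
  is at most the value of \<open>L\<close> at \<open>n - 1\<close>. In a disconnected graph every strategy is of this
  kind.

  Suppose now that the graph is connected and that at least three vertices can be deleted, one
  at a time, without disconnecting it. A strategy is cut into phases, minimal segments that
  cross every cut. Fewer than \<open>2 q\<^sub>n\<close> phases are replaced one by one with the previous bound, at
  a total cost of at most \<open>L\<^sub>n\<close>. But each phase reduces the energy of a vector of mean zero by
  the factor \<open>1 - 2 / n\<^sup>2\<close> (\<open>crosses_every_cut_contracts\<close>), so \<open>2 q\<^sub>n\<close> phases push the value to
  within a tiny amount of the value of complete averaging, and a strategy of six moves does at
  least as well (\<open>large_short_value\<close>).

  A connected graph without three such vertices is a path (\<open>path_order_exists\<close>), and there the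
  last step fails: if \<open>x\<close> decreases and \<open>z\<close> increases along the path, nothing is better than
  complete averaging. On a path, however, at most one move has to contain the first vertex
  (\<open>at_most_one_first_block_move\<close>), and it follows by induction that \<open>2 ^ (n - 1) - 1\<close> moves
  suffice.
\<close>

section \<open>Averaging operators and the bilinear form\<close>

text \<open>
  The bilinear form \<open>x \<cdot> z\<close> over the coordinates in \<open>V\<close>. With the indicator of a vertex in place
  of \<open>x\<close> it is evaluation at that vertex.
\<close>

definition ip :: "'v set \<Rightarrow> ('v \<Rightarrow> real) \<Rightarrow> ('v \<Rightarrow> real) \<Rightarrow> real" where
  "ip V x z = (\<Sum>v\<in>V. x v * z v)"

lemma strategy_op_Nil [simp]: "strategy_op [] z = z"
  by (simp add: strategy_op_def)

lemma strategy_op_Cons [simp]: "strategy_op (S # \<sigma>) z = strategy_op \<sigma> (avg_op S z)"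
  by (simp add: strategy_op_def)

lemma strategy_op_append [simp]: "strategy_op (\<sigma> @ \<tau>) z = strategy_op \<tau> (strategy_op \<sigma> z)"
  by (simp add: strategy_op_def)

lemma ip_commute: "ip V x z = ip V z x"
  by (simp add: ip_def mult.commute)

lemma ip_cong: "(\<And>v. v \<in> V \<Longrightarrow> x v = x' v) \<Longrightarrow> (\<And>v. v \<in> V \<Longrightarrow> z v = z' v) \<Longrightarrow> ip V x z = ip V x' z'"
  by (simp add: ip_def)

lemma ip_disjoint_union:
  "finite A \<Longrightarrow> finite B \<Longrightarrow> A \<inter> B = {} \<Longrightarrow> ip (A \<union> B) x z = ip A x z + ip B x z"
  by (simp add: ip_def sum.union_disjoint)

lemma ip_self_nonneg: "0 \<le> ip V z z"
  by (auto simp: ip_def intro: sum_nonneg)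

lemma ip_Cauchy_Schwarz: "(ip V x z)\<^sup>2 \<le> ip V x x * ip V z z"
  using Cauchy_Schwarz_ineq_sum[of x z V] by (simp add: ip_def power2_eq_square)

lemma avg_op_empty [simp]: "avg_op {} z = z"
  by (simp add: avg_op_def fun_eq_iff)

lemma avg_op_constant:
  assumes "finite S" "\<And>v. v \<in> S \<Longrightarrow> z v = c"
  shows "avg_op S z = z"
proof
  fix v show "avg_op S z v = z v"
    using assms by (auto simp: avg_op_def)
qed

lemma avg_op_in: "v \<in> S \<Longrightarrow> avg_op S z v = (\<Sum>u\<in>S. z u) / real (card S)"
  and avg_op_notin: "v \<notin> S \<Longrightarrow> avg_op S z v = z v"
  by (simp_all add: avg_op_def)

lemma sum_avg_op_self: "finite S \<Longrightarrow> (\<Sum>v\<in>S. avg_op S z v) = (\<Sum>v\<in>S. z v)"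
  by (cases "S = {}") (simp_all add: avg_op_def)

lemma avg_op_absorb_left:
  assumes "finite S" "T \<subseteq> S"
  shows "avg_op T (avg_op S z) = avg_op S z"
  using assms by (intro avg_op_constant[where c = "(\<Sum>u\<in>S. z u) / real (card S)"])
    (auto simp: avg_op_def intro: finite_subset)

lemma avg_op_absorb_right:
  assumes "finite S" "T \<subseteq> S"
  shows "avg_op S (avg_op T z) = avg_op S z"
proof -
  have "(\<Sum>v\<in>S. avg_op T z v) = (\<Sum>v\<in>T. avg_op T z v) + (\<Sum>v\<in>S - T. avg_op T z v)"
    using assms by (metis add.commute sum.subset_diff)
  also have "\<dots> = (\<Sum>v\<in>T. z v) + (\<Sum>v\<in>S - T. z v)"
    using assms by (simp add: sum_avg_op_self finite_subset avg_op_notin)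
  also have "\<dots> = (\<Sum>v\<in>S. z v)"
    using assms by (metis add.commute sum.subset_diff)
  finally show ?thesis
    using assms by (auto simp: avg_op_def fun_eq_iff)
qed

lemma avg_op_commute:
  assumes "S \<inter> T = {}"
  shows "avg_op S (avg_op T z) = avg_op T (avg_op S z)"
proof -
  have "(\<Sum>u\<in>S. avg_op T z u) = (\<Sum>u\<in>S. z u)" "(\<Sum>u\<in>T. avg_op S z u) = (\<Sum>u\<in>T. z u)"
    using assms by (auto intro!: sum.cong simp: avg_op_def)
  then show ?thesis
    using assms by (auto simp: avg_op_def fun_eq_iff)
qed

lemma avg_op_strategy_op_commute:
  assumes "\<And>T. T \<in> set \<sigma> \<Longrightarrow> S \<inter> T = {}"
  shows "avg_op S (strategy_op \<sigma> z) = strategy_op \<sigma> (avg_op S z)"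
  using assms by (induction \<sigma> arbitrary: z) (simp_all add: avg_op_commute)

lemma strategy_op_notin:
  assumes "\<And>S. S \<in> set \<sigma> \<Longrightarrow> v \<notin> S"
  shows "strategy_op \<sigma> z v = z v"
  using assms by (induction \<sigma> arbitrary: z) (simp_all add: avg_op_notin)

text \<open>
  Averaging over \<open>M\<close> changes the form by minus \<open>card M\<close> times the covariance of \<open>x\<close> and \<open>z\<close> on
  \<open>M\<close>. A covariance does not see constants, so both vectors may be shifted freely.
\<close>

lemma ip_avg_op:
  assumes "finite V" "M \<subseteq> V"
  shows "ip V x (avg_op M z) = ip V x z - (\<Sum>v\<in>M. (x v - d) * (z v - c))
           + (\<Sum>v\<in>M. x v - d) * (\<Sum>v\<in>M. z v - c) / real (card M)"
proof (cases "M = {}")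
  case True
  then show ?thesis by (simp add: avg_op_def ip_def)
next
  case False
  have fin: "finite M" using assms finite_subset by blast
  with False have pos: "real (card M) > 0" by (simp add: card_gt_0_iff)
  define m X Z where "m = real (card M)" and "X = (\<Sum>v\<in>M. x v)" and "Z = (\<Sum>v\<in>M. z v)"
  have m: "m \<noteq> 0" using pos by (simp add: m_def)
  have split: "ip V x y = ip M x y + ip (V - M) x y" for y
    unfolding ip_def using assms by (metis add.commute sum.subset_diff)
  have "ip M x (avg_op M z) = (\<Sum>v\<in>M. x v * (Z / m))"
    by (simp add: ip_def avg_op_def m_def Z_def)
  also have "\<dots> = X * Z / m"
    unfolding X_def sum_distrib_right[symmetric] by simp
  finally have 1: "ip V x (avg_op M z) - ip V x z = X * Z / m - ip M x z"
    unfolding split by (simp add: ip_def avg_op_notin)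
  have 2: "(\<Sum>v\<in>M. (x v - d) * (z v - c)) = ip M x z - c * X - d * Z + m * c * d"
    unfolding ip_def X_def Z_def m_def
    by (simp add: algebra_simps sum.distrib sum_subtractf sum_distrib_left)
  have 3: "(\<Sum>v\<in>M. x v - d) = X - m * d" "(\<Sum>v\<in>M. z v - c) = Z - m * c"
    by (simp_all add: X_def Z_def m_def sum_subtractf)
  have "(X - m * d) * (Z - m * c) / m = X * Z / m - c * X - d * Z + m * c * d"
    using m by (simp add: field_simps)
  then show ?thesis
    using 1 unfolding 2 3 m_def[symmetric] by simp
qed

lemma avg_op_self_adjoint:
  assumes "finite V" "M \<subseteq> V"
  shows "ip V (avg_op M x) z = ip V x (avg_op M z)"
proof -
  have "ip V (avg_op M x) z = ip V z (avg_op M x)" by (rule ip_commute)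
  then show ?thesis
    using ip_avg_op[OF assms, of z x 0 0] ip_avg_op[OF assms, of x z 0 0]
    by (simp add: ip_commute mult.commute)
qed

lemma strategy_op_adjoint:
  assumes "finite V" "\<And>S. S \<in> set \<sigma> \<Longrightarrow> S \<subseteq> V"
  shows "ip V (strategy_op (rev \<sigma>) x) z = ip V x (strategy_op \<sigma> z)"
  using assms(2)
  by (induction \<sigma> arbitrary: z) (simp_all add: avg_op_self_adjoint assms(1))

text \<open>
  What comes after a segment of a strategy can be transferred to \<open>x\<close>, and what comes before it
  belongs to \<open>z\<close>. A bound that holds for all \<open>x\<close> and \<open>z\<close> therefore applies to any segment of a
  longer strategy.
\<close>

lemma ip_strategy_segment:
  assumes "finite V" "\<And>S. S \<in> set \<gamma> \<Longrightarrow> S \<subseteq> V"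
  shows "ip V x (strategy_op (\<alpha> @ \<beta> @ \<gamma>) z)
       = ip V (strategy_op (rev \<gamma>) x) (strategy_op \<beta> (strategy_op \<alpha> z))"
  using assms by (simp add: strategy_op_adjoint)

lemma avg_op_energy:
  assumes "finite V" "M \<subseteq> V" "M \<noteq> {}"
  shows "ip V (avg_op M z) (avg_op M z)
       = ip V z z - (\<Sum>v\<in>M. (z v - (\<Sum>u\<in>M. z u) / real (card M))\<^sup>2)"
proof -
  have fin: "finite M" using assms finite_subset by blast
  define c where "c = (\<Sum>u\<in>M. z u) / real (card M)"
  have "(\<Sum>v\<in>M. z v - c) = 0"
    using fin assms(3) by (simp add: c_def sum_subtractf)
  moreover have "ip V (avg_op M z) (avg_op M z) = ip V z (avg_op M z)"
    using assms fin by (simp add: avg_op_self_adjoint avg_op_absorb_left)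
  ultimately show ?thesis
    using ip_avg_op[OF assms(1,2), of z z c c] by (simp add: c_def power2_eq_square)
qed

lemma avg_op_energy_le:
  assumes "finite V" "M \<subseteq> V"
  shows "ip V (avg_op M z) (avg_op M z) \<le> ip V z z"
proof (cases "M = {}")
  case True
  then show ?thesis by (simp add: avg_op_def ip_def)
next
  case False
  then show ?thesis
    using avg_op_energy[OF assms False, of z] by (simp add: sum_nonneg)
qed

lemma avg_op_energy_drop:
  assumes "finite V" "M \<subseteq> V" "p \<in> M" "q \<in> M"
  shows "ip V (avg_op M z) (avg_op M z) \<le> ip V z z - (z p - z q)\<^sup>2 / 2"
proof (cases "p = q")
  case True
  then show ?thesis using avg_op_energy_le[OF assms(1,2)] by simp
next
  case False
  have fin: "finite M" using assms finite_subset by blast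
  define c where "c = (\<Sum>u\<in>M. z u) / real (card M)"
  have "(z p - z q)\<^sup>2 / 2 = (z p - c)\<^sup>2 + (z q - c)\<^sup>2 - ((z p - c) + (z q - c))\<^sup>2 / 2"
    by (simp add: power2_eq_square field_simps)
  also have "\<dots> \<le> (z p - c)\<^sup>2 + (z q - c)\<^sup>2" by simp
  also have "\<dots> = (\<Sum>v\<in>{p, q}. (z v - c)\<^sup>2)" using False by simp
  also have "\<dots> \<le> (\<Sum>v\<in>M. (z v - c)\<^sup>2)"
    using assms fin by (intro sum_mono2) auto
  finally have drop: "(z p - z q)\<^sup>2 / 2 \<le> (\<Sum>v\<in>M. (z v - c)\<^sup>2)" .
  have "M \<noteq> {}" using assms(3) by auto
  show ?thesis
    using drop unfolding avg_op_energy[OF assms(1,2) \<open>M \<noteq> {}\<close>] c_def by (rule diff_left_mono)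
qed

lemma strategy_op_energy_le:
  assumes "finite V" "\<And>S. S \<in> set \<sigma> \<Longrightarrow> S \<subseteq> V"
  shows "ip V (strategy_op \<sigma> z) (strategy_op \<sigma> z) \<le> ip V z z"
  using assms(2)
proof (induction \<sigma> arbitrary: z)
  case (Cons S \<sigma>)
  then show ?case
    using avg_op_energy_le[OF assms(1), of S z] by (fastforce intro: order_trans)
qed simp

lemma sum_strategy_op:
  assumes "finite V" "\<And>S. S \<in> set \<sigma> \<Longrightarrow> S \<subseteq> V"
  shows "(\<Sum>v\<in>V. strategy_op \<sigma> z v) = (\<Sum>v\<in>V. z v)"
proof -
  have one: "strategy_op \<tau> (\<lambda>v. 1) = (\<lambda>v. 1)" if "\<And>S. S \<in> set \<tau> \<Longrightarrow> S \<subseteq> V" for \<tau>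
    using that
  proof (induction \<tau>)
    case (Cons S \<tau>)
    have "finite S" using Cons.prems[of S] assms(1) by (auto intro: finite_subset)
    then have "avg_op S (\<lambda>v. 1) = (\<lambda>v. 1)" by (rule avg_op_constant) simp
    then show ?case using Cons by simp
  qed simp
  have "ip V (strategy_op (rev \<sigma>) (\<lambda>v. 1)) z = ip V (\<lambda>v. 1) (strategy_op \<sigma> z)"
    using assms by (rule strategy_op_adjoint)
  then show ?thesis using assms one[of "rev \<sigma>"] by (simp add: ip_def)
qed

lemma strategy_op_add_const:
  assumes "\<And>S. S \<in> set \<sigma> \<Longrightarrow> finite S \<and> S \<noteq> {}"
  shows "strategy_op \<sigma> (\<lambda>v. z v + c) = (\<lambda>v. strategy_op \<sigma> z v + c)"
  using assms
proof (induction \<sigma> arbitrary: z)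
  case (Cons S \<sigma>)
  have "avg_op S (\<lambda>v. z v + c) = (\<lambda>v. avg_op S z v + c)"
    using Cons.prems[of S] by (auto simp: avg_op_def fun_eq_iff sum.distrib add_divide_distrib)
  then show ?case using Cons by simp
qed simp

section \<open>Strategies on a path\<close>

text \<open>
  Consecutive vertices of a path are grouped into blocks, listed in order along the path; a move
  is a union of contiguous blocks. Merging the first two blocks gives a shorter list of the same
  kind, whose moves are moves of the original list: this is what the inductions below use.
  Single blocks count as moves, also when the block has only one vertex and averaging over it
  does nothing.
\<close>

definition contiguous_unions :: "'v set list \<Rightarrow> 'v set set" where
  "contiguous_unions bs = {\<Union>(set m) |l m r. bs = l @ m @ r \<and> m \<noteq> []}"

text \<open>
  For disjoint nonempty blocks, these are the moves that contain the first block.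
\<close>

definition prefix_unions :: "'v set list \<Rightarrow> 'v set set" where
  "prefix_unions bs = {\<Union>(set m) |m r. bs = m @ r \<and> m \<noteq> []}"

text \<open>
  The blocks are nonempty, pairwise disjoint subsets of \<open>V\<close>.
\<close>

definition block_list :: "'v set \<Rightarrow> 'v set list \<Rightarrow> bool" where
  "block_list V bs \<longleftrightarrow>
     (\<forall>b\<in>set bs. b \<noteq> {} \<and> b \<subseteq> V) \<and> sorted_wrt (\<lambda>A B. A \<inter> B = {}) bs"

lemma prefix_unions_Nil [simp]: "prefix_unions [] = {}"
  by (auto simp: prefix_unions_def)

lemma contiguous_unions_Nil [simp]: "contiguous_unions [] = {}"
  by (auto simp: contiguous_unions_def)

lemma prefix_unions_Cons: "prefix_unions (b # bs) = insert b ((\<union>) b ` prefix_unions bs)"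
proof (intro subset_antisym subsetI)
  fix S assume "S \<in> prefix_unions (b # bs)"
  then obtain m r where m: "b # bs = m @ r" "m \<noteq> []" "S = \<Union>(set m)"
    by (auto simp: prefix_unions_def)
  then obtain m' where m': "m = b # m'" "bs = m' @ r" by (cases m) auto
  show "S \<in> insert b ((\<union>) b ` prefix_unions bs)"
  proof (cases "m' = []")
    case False
    then have "\<Union>(set m') \<in> prefix_unions bs" using m' by (auto simp: prefix_unions_def)
    then show ?thesis using m m' by auto
  qed (use m m' in auto)
next
  fix S assume "S \<in> insert b ((\<union>) b ` prefix_unions bs)"
  then consider "S = b" | T where "T \<in> prefix_unions bs" "S = b \<union> T" by auto
  then show "S \<in> prefix_unions (b # bs)"
  proof cases
    case 1
    then show ?thesis
      unfolding prefix_unions_def by (intro CollectI exI[of _ "[b]"] exI[of _ bs]) simp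
  next
    case 2
    then obtain m r where "bs = m @ r" "T = \<Union>(set m)" by (auto simp: prefix_unions_def)
    with 2 show ?thesis
      unfolding prefix_unions_def by (intro CollectI exI[of _ "b # m"] exI[of _ r]) simp
  qed
qed

lemma contiguous_unions_Cons:
  "contiguous_unions (b # bs) = prefix_unions (b # bs) \<union> contiguous_unions bs"
proof (intro subset_antisym subsetI)
  fix S assume "S \<in> contiguous_unions (b # bs)"
  then obtain l m r where m: "b # bs = l @ m @ r" "m \<noteq> []" "S = \<Union>(set m)"
    by (auto simp: contiguous_unions_def)
  show "S \<in> prefix_unions (b # bs) \<union> contiguous_unions bs"
  proof (cases l)
    case Nil
    then show ?thesis using m by (auto simp: prefix_unions_def)
  next
    case (Cons a l')
    then show ?thesis using m by (auto simp: contiguous_unions_def)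
  qed
next
  fix S assume "S \<in> prefix_unions (b # bs) \<union> contiguous_unions bs"
  then show "S \<in> contiguous_unions (b # bs)"
  proof
    assume "S \<in> prefix_unions (b # bs)"
    then show ?thesis unfolding prefix_unions_def contiguous_unions_def by (force intro: exI[of _ "[]"])
  next
    assume "S \<in> contiguous_unions bs"
    then obtain l m r where "bs = l @ m @ r" "m \<noteq> []" "S = \<Union>(set m)"
      by (auto simp: contiguous_unions_def)
    then show ?thesis
      unfolding contiguous_unions_def
      by (intro CollectI exI[of _ "b # l"] exI[of _ m] exI[of _ r]) simp
  qed
qed

lemma contiguous_unions_subset: "S \<in> contiguous_unions bs \<Longrightarrow> S \<subseteq> \<Union>(set bs)"
  by (auto simp: contiguous_unions_def)

lemma block_list_Cons:
  "block_list V (b # bs) \<longleftrightarrow> b \<noteq> {} \<and> b \<subseteq> V \<and> b \<inter> \<Union>(set bs) = {} \<and> block_list V bs"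
  by (auto simp: block_list_def)

lemma contiguous_unions_in: "block_list V bs \<Longrightarrow> S \<in> contiguous_unions bs \<Longrightarrow> S \<subseteq> V"
  using contiguous_unions_subset[of S bs] by (auto simp: block_list_def)

lemma prefix_unions_two:
  "prefix_unions (b1 # b2 # bs) = insert b1 (prefix_unions ((b1 \<union> b2) # bs))"
  by (auto simp: prefix_unions_Cons image_iff Un_assoc)

lemma contiguous_unions_merge:
  "contiguous_unions ((b1 \<union> b2) # bs) \<subseteq> contiguous_unions (b1 # b2 # bs)"
  by (auto simp: contiguous_unions_Cons prefix_unions_two)

lemma first_block_subset_iff:
  assumes "block_list V (b # bs)" "S \<in> contiguous_unions (b # bs)"
  shows "b \<subseteq> S \<longleftrightarrow> S \<in> prefix_unions (b # bs)"
    and "\<not> b \<subseteq> S \<longleftrightarrow> S \<in> contiguous_unions bs"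
proof -
  have "\<not> b \<subseteq> S" if "S \<in> contiguous_unions bs"
    using contiguous_unions_subset[OF that] assms(1) unfolding block_list_Cons by blast
  moreover have "b \<subseteq> S" if "S \<in> prefix_unions (b # bs)"
    using that by (auto simp: prefix_unions_Cons)
  ultimately show "b \<subseteq> S \<longleftrightarrow> S \<in> prefix_unions (b # bs)"
    and "\<not> b \<subseteq> S \<longleftrightarrow> S \<in> contiguous_unions bs"
    using assms(2) by (auto simp: contiguous_unions_Cons)
qed

lemma filter_two:
  assumes "2 \<le> length (filter P xs)"
  obtains \<alpha> s \<beta> t \<gamma> where "xs = \<alpha> @ s # \<beta> @ t # \<gamma>" "P s" "P t" "\<forall>y\<in>set \<beta>. \<not> P y"
proof -
  obtain s t us where "filter P xs = s # t # us"
    using assms by (metis Suc_le_length_iff numeral_2_eq_2)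
  then show ?thesis
    using that by (metis filter_eq_Cons_iff)
qed

lemma filter_at_most_one:
  assumes "length (filter P xs) \<le> 1"
  obtains "\<forall>y\<in>set xs. \<not> P y"
  | \<alpha> s \<gamma> where "xs = \<alpha> @ s # \<gamma>" "P s" "\<forall>y\<in>set \<alpha> \<union> set \<gamma>. \<not> P y"
proof (cases "filter P xs")
  case Nil
  then show ?thesis using that(1) by (simp add: filter_empty_conv)
next
  case (Cons s us)
  then have "us = []" using assms by simp
  with Cons obtain \<alpha> \<gamma> where "xs = \<alpha> @ s # \<gamma>" "P s" "\<forall>y\<in>set \<alpha>. \<not> P y" "filter P \<gamma> = []"
    by (auto simp: filter_eq_Cons_iff)
  then have "\<forall>y\<in>set \<alpha> \<union> set \<gamma>. \<not> P y" by (auto simp: filter_empty_conv)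
  then show ?thesis using that(2) \<open>xs = _\<close> \<open>P s\<close> by blast
qed

text \<open>
  If \<open>x\<close> and \<open>z\<close> are constant on \<open>B\<close>, the value of averaging over \<open>W \<union> U\<close> with \<open>W \<subseteq> B\<close> is
  \<open>K + X * Y / (card W + card U)\<close>, where \<open>K\<close>, \<open>X\<close> and \<open>Y\<close> do not depend on \<open>W\<close>. It is monotone
  in \<open>card W\<close>, so one of the extreme choices \<open>W = {}\<close> and \<open>W = B\<close> is at least as good as
  \<open>W = A\<close>.
\<close>

lemma exchange_on_constant_block:
  assumes fin: "finite V" and sub: "A \<subseteq> B" "B \<subseteq> V" "U \<subseteq> V" and ne: "A \<noteq> {}"
    and dis: "B \<inter> U = {}"
    and x: "\<And>v. v \<in> B \<Longrightarrow> x v = d" and z: "\<And>v. v \<in> B \<Longrightarrow> z v = c"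
  shows "ip V x (avg_op (A \<union> U) z) \<le> ip V x (avg_op U z)
       \<or> ip V x (avg_op (A \<union> U) z) \<le> ip V x (avg_op (B \<union> U) z)"
proof -
  define X Y where "X = (\<Sum>v\<in>U. x v - d)" and "Y = (\<Sum>v\<in>U. z v - c)"
  define K where "K = ip V x z - (\<Sum>v\<in>U. (x v - d) * (z v - c))"
  have finB: "finite B" "finite U" using fin sub by (auto intro: finite_subset)
  have val: "ip V x (avg_op (W \<union> U) z) = K + X * Y / real (card W + card U)" if "W \<subseteq> B" for W
  proof -
    have W: "W \<subseteq> V" "W \<inter> U = {}" "finite W" using that sub dis finB by (auto intro: finite_subset)
    then have "(\<Sum>v\<in>W \<union> U. (x v - d) * (z v - c)) = (\<Sum>v\<in>U. (x v - d) * (z v - c))"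
      "(\<Sum>v\<in>W \<union> U. x v - d) = X" "(\<Sum>v\<in>W \<union> U. z v - c) = Y"
      using that x z finB by (auto simp: sum.union_disjoint X_def Y_def subset_iff intro!: sum.neutral)
    then show ?thesis
      using ip_avg_op[OF fin, of "W \<union> U" x z d c] W sub finB by (simp add: K_def card_Un_disjoint)
  qed
  have A: "card A \<le> card B" "0 < card A" using sub ne finB by (auto intro: card_mono simp: card_gt_0_iff finite_subset)
  show ?thesis
  proof (cases "0 \<le> X * Y")
    case True
    have "X * Y / real (card A + card U) \<le> X * Y / real (0 + card U)" if "U \<noteq> {}"
    proof -
      have "0 < card U" using that finB by (simp add: card_gt_0_iff)
      then show ?thesis using True by (intro divide_left_mono) auto
    qed
    moreover have "X * Y = 0" if "U = {}" using that by (simp add: X_def)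
    ultimately have "X * Y / real (card A + card U) \<le> X * Y / real (card {} + card U)"
      by (cases "U = {}") auto
    then show ?thesis using val[of A] val[of "{}"] sub by simp
  next
    case False
    then have "X * Y / real (card A + card U) \<le> X * Y / real (card B + card U)"
      using A by (intro divide_left_mono_neg) auto
    then show ?thesis using val[of A] val[of B] sub by simp
  qed
qed

text \<open>
  The heart of the argument for paths. Let \<open>S1\<close> and \<open>S2\<close> be successive moves that contain the
  first block \<open>b\<close>, with moves \<open>\<beta>\<close> that avoid \<open>b\<close> in between. Unless one of them is \<open>b\<close> itself,
  both contain the first two blocks. By the hypothesis for the list without \<open>b\<close>, at most one
  move of \<open>\<beta>\<close> has to contain the second block, and by the exchange lemma it can be made to
  contain both of the first two blocks or neither. Then no move separates these two blocks, and
  the hypothesis for the list in which they are merged leaves only one move that contains \<open>b\<close>.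
\<close>

lemma merge_first_block_moves:
  assumes fin: "finite V" and bl: "block_list V (b # bs)"
    and IH: "\<And>bs' \<sigma> x z. length bs' < length (b # bs) \<Longrightarrow> bs' \<noteq> [] \<Longrightarrow> block_list V bs' \<Longrightarrow>
        set \<sigma> \<subseteq> contiguous_unions bs' \<Longrightarrow>
        \<exists>\<sigma>'. set \<sigma>' \<subseteq> contiguous_unions bs' \<and> length (filter (\<lambda>S. hd bs' \<subseteq> S) \<sigma>') \<le> 1 \<and>
             ip V x (strategy_op \<sigma> z) \<le> ip V x (strategy_op \<sigma>' z)"
    and S: "S1 \<in> prefix_unions (b # bs)" "S2 \<in> prefix_unions (b # bs)"
    and \<beta>: "set \<beta> \<subseteq> contiguous_unions bs"
  shows "\<exists>\<delta>. set \<delta> \<subseteq> contiguous_unions (b # bs) \<and> length (filter (\<lambda>S. b \<subseteq> S) \<delta>) \<le> 1 \<and>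
             ip V x (strategy_op (S1 # \<beta> @ [S2]) z) \<le> ip V x (strategy_op \<delta> z)"
proof -
  have Scu: "S1 \<in> contiguous_unions (b # bs)" "S2 \<in> contiguous_unions (b # bs)"
    using S by (auto simp: contiguous_unions_Cons)
  then have SV: "S1 \<subseteq> V" "S2 \<subseteq> V" using contiguous_unions_in[OF bl] by auto
  have finS: "finite S1" "finite S2" using SV fin by (auto intro: finite_subset)
  have bS: "b \<subseteq> S1" "b \<subseteq> S2" using first_block_subset_iff(1)[OF bl] Scu S by auto
  have \<beta>cu: "set \<beta> \<subseteq> contiguous_unions (b # bs)" using \<beta> by (auto simp: contiguous_unions_Cons)
  have \<beta>b: "filter (\<lambda>S. b \<subseteq> S) \<beta> = []"
    using first_block_subset_iff(2)[OF bl] \<beta> \<beta>cu by (auto simp: filter_empty_conv)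
  have dis: "b \<inter> T = {}" if "T \<in> set \<beta>" for T
    using contiguous_unions_subset[of T bs] that \<beta> bl unfolding block_list_Cons by blast
  consider "S1 = b" | "S2 = b" | "S1 \<noteq> b" "S2 \<noteq> b" by blast
  then show ?thesis
  proof cases
    case 1
    have "strategy_op (S1 # \<beta> @ [S2]) z = strategy_op (\<beta> @ [S2]) z"
      using 1 avg_op_strategy_op_commute[of \<beta> b z, OF dis, symmetric]
        avg_op_absorb_right[OF finS(2) bS(2)] by simp
    then show ?thesis
      using \<beta>cu Scu \<beta>b by (intro exI[of _ "\<beta> @ [S2]"]) simp
  next
    case 2
    have "strategy_op (S1 # \<beta> @ [S2]) z = strategy_op (S1 # \<beta>) z"
      using 2 dis avg_op_strategy_op_commute[of \<beta> b "avg_op S1 z"] avg_op_absorb_left[OF finS(1) bS(1)]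
      by simp
    then show ?thesis
      using \<beta>cu Scu \<beta>b by (intro exI[of _ "S1 # \<beta>"]) simp
  next
    case 3
    then obtain b2 bs' where bs: "bs = b2 # bs'"
      using S by (cases bs) (auto simp: prefix_unions_Cons)
    define B where "B = b \<union> b2"
    have blB: "block_list V (B # bs')" and bl2: "block_list V (b2 # bs')"
      and dis2: "b2 \<inter> \<Union>(set bs') = {}" "B \<inter> \<Union>(set bs') = {}" "B \<subseteq> V" "b2 \<noteq> {}" "b2 \<subseteq> V"
      using bl by (auto simp: bs B_def block_list_Cons)
    have SB: "S1 \<in> prefix_unions (B # bs')" "S2 \<in> prefix_unions (B # bs')"
      using S 3 by (auto simp: bs B_def prefix_unions_two)
    then have BS: "B \<subseteq> S1" "B \<subseteq> S2" by (auto simp: prefix_unions_Cons)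
    have tl: "contiguous_unions bs' \<subseteq> contiguous_unions (B # bs')" by (auto simp: contiguous_unions_Cons)
    have disB: "v \<notin> T" if "v \<in> B" "T \<in> contiguous_unions bs'" for v T
      using that dis2 contiguous_unions_subset[of T bs'] by blast
    \<comment> \<open>These vectors are constant on \<open>S2\<close> and on \<open>S1\<close>, hence both are constant on \<open>B\<close>.\<close>
    define x2 z1 where "x2 = avg_op S2 x" and "z1 = avg_op S1 z"
    have val: "ip V x (strategy_op (S1 # \<gamma> @ [S2]) z) = ip V x2 (strategy_op \<gamma> z1)" for \<gamma>
      by (simp add: x2_def z1_def avg_op_self_adjoint fin SV)
    obtain \<beta>' where \<beta>': "set \<beta>' \<subseteq> contiguous_unions (b2 # bs')"
      "length (filter (\<lambda>S. b2 \<subseteq> S) \<beta>') \<le> 1"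
      "ip V x2 (strategy_op \<beta> z1) \<le> ip V x2 (strategy_op \<beta>' z1)"
      using IH[of "b2 # bs'" \<beta> x2 z1] bl2 \<beta> by (auto simp: bs)
    have "\<exists>\<beta>''. set \<beta>'' \<subseteq> contiguous_unions (B # bs') \<and>
            ip V x2 (strategy_op \<beta>' z1) \<le> ip V x2 (strategy_op \<beta>'' z1)"
      using \<beta>'(2)
    proof (cases rule: filter_at_most_one)
      case 1
      then have "set \<beta>' \<subseteq> contiguous_unions bs'"
        using \<beta>'(1) first_block_subset_iff(2)[OF bl2] by blast
      then show ?thesis using tl by blast
    next
      case (2 \<alpha> T \<gamma>)
      have sub: "set \<alpha> \<subseteq> contiguous_unions bs'" "set \<gamma> \<subseteq> contiguous_unions bs'"
        using 2(1,3) \<beta>'(1) first_block_subset_iff(2)[OF bl2] by (auto simp: subset_iff)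
      have T: "T \<in> prefix_unions (b2 # bs')"
        using 2(1,2) \<beta>'(1) first_block_subset_iff(1)[OF bl2] by auto
      have bl': "block_list V bs'" using bl2 by (simp add: block_list_Cons)
      obtain U where U: "T = b2 \<union> U" "U = {} \<or> U \<in> prefix_unions bs'"
        using T by (auto simp: prefix_unions_Cons)
      have UV: "U \<subseteq> V" "B \<inter> U = {}"
      proof -
        have "U = {} \<or> U \<in> contiguous_unions bs'"
          using U(2) by (cases bs') (auto simp: contiguous_unions_Cons)
        then show "U \<subseteq> V" "B \<inter> U = {}"
          using contiguous_unions_in[OF bl'] disB by auto
      qed
      define x3 z2 where "x3 = strategy_op (rev \<gamma>) x2" and "z2 = strategy_op \<alpha> z1"
      have x3: "x3 v = (\<Sum>u\<in>S2. x u) / real (card S2)" if "v \<in> B" for v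
        unfolding x3_def x2_def using that BS disB sub
        by (subst strategy_op_notin) (auto simp: avg_op_in)
      have z2: "z2 v = (\<Sum>u\<in>S1. z u) / real (card S1)" if "v \<in> B" for v
        unfolding z2_def z1_def using that BS disB sub
        by (subst strategy_op_notin) (auto simp: avg_op_in)
      have "S \<subseteq> V" if "S \<in> set \<gamma>" for S using that sub contiguous_unions_in[OF bl'] by blast
      then have seg: "ip V x2 (strategy_op (\<alpha> @ \<mu> @ \<gamma>) z1) = ip V x3 (strategy_op \<mu> z2)" for \<mu>
        unfolding x3_def z2_def by (rule ip_strategy_segment[OF fin])
      have "b2 \<subseteq> B" by (simp add: B_def)
      from exchange_on_constant_block[of V b2 B U x3 _ z2, OF fin this dis2(3) UV(1) dis2(4) UV(2) x3 z2]
      consider "ip V x3 (avg_op T z2) \<le> ip V x3 (avg_op U z2)"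
        | "ip V x3 (avg_op T z2) \<le> ip V x3 (avg_op (B \<union> U) z2)" by (auto simp: U)
      then show ?thesis
      proof cases
        case 1
        show ?thesis
        proof (cases "U = {}")
          case True
          then have "ip V x2 (strategy_op \<beta>' z1) \<le> ip V x2 (strategy_op (\<alpha> @ [] @ \<gamma>) z1)"
            using 1 seg[of "[T]"] seg[of "[]"] \<open>\<beta>' = _\<close> by simp
          then show ?thesis using sub tl by (intro exI[of _ "\<alpha> @ [] @ \<gamma>"]) auto
        next
          case False
          then have "U \<in> contiguous_unions bs'"
            using U(2) by (cases bs') (auto simp: contiguous_unions_Cons)
          moreover have "ip V x2 (strategy_op \<beta>' z1) \<le> ip V x2 (strategy_op (\<alpha> @ [U] @ \<gamma>) z1)"
            using 1 seg[of "[T]"] seg[of "[U]"] \<open>\<beta>' = _\<close> by simp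
          ultimately show ?thesis using sub tl by (intro exI[of _ "\<alpha> @ [U] @ \<gamma>"]) auto
        qed
      next
        case 2
        have "B \<union> U \<in> contiguous_unions (B # bs')"
          using U(2) by (auto simp: contiguous_unions_Cons prefix_unions_Cons)
        moreover have "ip V x2 (strategy_op \<beta>' z1) \<le> ip V x2 (strategy_op (\<alpha> @ [B \<union> U] @ \<gamma>) z1)"
          using 2 seg[of "[T]"] seg[of "[B \<union> U]"] \<open>\<beta>' = _\<close> by simp
        ultimately show ?thesis using sub tl by (intro exI[of _ "\<alpha> @ [B \<union> U] @ \<gamma>"]) auto
      qed
    qed
    then obtain \<beta>'' where \<beta>'': "set \<beta>'' \<subseteq> contiguous_unions (B # bs')"
      "ip V x2 (strategy_op \<beta>' z1) \<le> ip V x2 (strategy_op \<beta>'' z1)" by blast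
    have "set (S1 # \<beta>'' @ [S2]) \<subseteq> contiguous_unions (B # bs')"
      using SB \<beta>'' by (auto simp: contiguous_unions_Cons)
    then obtain \<delta> where \<delta>: "set \<delta> \<subseteq> contiguous_unions (B # bs')"
      "length (filter (\<lambda>S. B \<subseteq> S) \<delta>) \<le> 1"
      "ip V x (strategy_op (S1 # \<beta>'' @ [S2]) z) \<le> ip V x (strategy_op \<delta> z)"
      using IH[of "B # bs'" "S1 # \<beta>'' @ [S2]" x z] blB by (auto simp: bs)
    have "b \<subseteq> T \<longleftrightarrow> B \<subseteq> T" if "T \<in> set \<delta>" for T
    proof
      assume "b \<subseteq> T"
      moreover have "b \<noteq> {}" "b \<subseteq> B" using bl by (auto simp: block_list_Cons B_def)
      ultimately have "T \<notin> contiguous_unions bs'" using disB by blast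
      then show "B \<subseteq> T" using first_block_subset_iff(2)[OF blB] that \<delta>(1) by blast
    qed (auto simp: B_def)
    then have "filter (\<lambda>S. b \<subseteq> S) \<delta> = filter (\<lambda>S. B \<subseteq> S) \<delta>"
      by (rule filter_cong[OF refl])
    moreover have "set \<delta> \<subseteq> contiguous_unions (b # bs)"
      using \<delta>(1) contiguous_unions_merge unfolding bs B_def by blast
    ultimately show ?thesis
      using \<delta> \<beta>' \<beta>'' val by (intro exI[of _ \<delta>]) force
  qed
qed

lemma at_most_one_first_block_move:
  assumes fin: "finite V" and "bs \<noteq> []" "block_list V bs" "set \<sigma> \<subseteq> contiguous_unions bs"
  shows "\<exists>\<sigma>'. set \<sigma>' \<subseteq> contiguous_unions bs \<and> length (filter (\<lambda>S. hd bs \<subseteq> S) \<sigma>') \<le> 1 \<and>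
             ip V x (strategy_op \<sigma> z) \<le> ip V x (strategy_op \<sigma>' z)"
  using assms(2-)
proof (induction "length bs" arbitrary: bs \<sigma> x z rule: less_induct)
  case (less bs)
  obtain b bs' where bs: "bs = b # bs'" using less.prems by (cases bs) auto
  note bl = less.prems(2)[unfolded bs]
  show ?case
    using less.prems(3)
  proof (induction "length (filter (\<lambda>S. hd bs \<subseteq> S) \<sigma>)" arbitrary: \<sigma> rule: less_induct)
    case inner: (less \<sigma>)
    show ?case
    proof (cases "length (filter (\<lambda>S. hd bs \<subseteq> S) \<sigma>) \<le> 1")
      case True
      then show ?thesis using inner.prems by blast
    next
      case False
      then have "2 \<le> length (filter (\<lambda>S. hd bs \<subseteq> S) \<sigma>)" by simp
      then obtain \<alpha> S1 \<beta> S2 \<gamma> where \<sigma>: "\<sigma> = \<alpha> @ S1 # \<beta> @ S2 # \<gamma>"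
        and S: "b \<subseteq> S1" "b \<subseteq> S2" and \<beta>: "\<forall>T\<in>set \<beta>. \<not> b \<subseteq> T"
        by (rule filter_two) (auto simp: bs)
      have cu: "set \<alpha> \<subseteq> contiguous_unions bs" "set \<gamma> \<subseteq> contiguous_unions bs"
        "set \<beta> \<subseteq> contiguous_unions bs" "S1 \<in> contiguous_unions bs" "S2 \<in> contiguous_unions bs"
        using inner.prems by (auto simp: \<sigma>)
      have "S1 \<in> prefix_unions (b # bs')" "S2 \<in> prefix_unions (b # bs')"
        using first_block_subset_iff(1)[OF bl] cu S by (auto simp: bs)
      moreover have "set \<beta> \<subseteq> contiguous_unions bs'"
        using first_block_subset_iff(2)[OF bl] cu(3) \<beta> by (auto simp: bs subset_iff)
      ultimately have seg: "\<exists>\<delta>. set \<delta> \<subseteq> contiguous_unions (b # bs') \<and>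
          length (filter (\<lambda>S. b \<subseteq> S) \<delta>) \<le> 1 \<and>
          ip V x (strategy_op (S1 # \<beta> @ [S2]) z) \<le> ip V x (strategy_op \<delta> z)" for x z
        using merge_first_block_moves[OF fin bl less.hyps[unfolded bs]] by blast
      have \<gamma>V: "T \<subseteq> V" if "T \<in> set \<gamma>" for T
        using that cu contiguous_unions_in less.prems(2) by blast
      obtain \<delta> where \<delta>: "set \<delta> \<subseteq> contiguous_unions bs" "length (filter (\<lambda>S. b \<subseteq> S) \<delta>) \<le> 1"
        "ip V (strategy_op (rev \<gamma>) x) (strategy_op (S1 # \<beta> @ [S2]) (strategy_op \<alpha> z))
         \<le> ip V (strategy_op (rev \<gamma>) x) (strategy_op \<delta> (strategy_op \<alpha> z))"
        using seg[of "strategy_op (rev \<gamma>) x" "strategy_op \<alpha> z"] by (auto simp: bs)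
      have better: "ip V x (strategy_op \<sigma> z) \<le> ip V x (strategy_op (\<alpha> @ \<delta> @ \<gamma>) z)"
        using \<delta>(3) ip_strategy_segment[of V \<gamma> x \<alpha> "S1 # \<beta> @ [S2]" z, OF fin \<gamma>V]
          ip_strategy_segment[of V \<gamma> x \<alpha> \<delta> z, OF fin \<gamma>V] by (simp add: \<sigma>)
      have "length (filter (\<lambda>S. hd bs \<subseteq> S) (\<alpha> @ \<delta> @ \<gamma>)) < length (filter (\<lambda>S. hd bs \<subseteq> S) \<sigma>)"
        using S \<delta>(2) by (simp add: \<sigma> bs)
      moreover have "set (\<alpha> @ \<delta> @ \<gamma>) \<subseteq> contiguous_unions bs" using \<delta> cu by simp
      ultimately obtain \<sigma>' where "set \<sigma>' \<subseteq> contiguous_unions bs"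
        "length (filter (\<lambda>S. hd bs \<subseteq> S) \<sigma>') \<le> 1"
        "ip V x (strategy_op (\<alpha> @ \<delta> @ \<gamma>) z) \<le> ip V x (strategy_op \<sigma>' z)"
        using inner.hyps by blast
      then show ?thesis using better by (intro exI[of _ \<sigma>']) simp
    qed
  qed
qed



text \<open>
  Before and after the only move that contains the first block, the strategy acts on the
  remaining blocks, so the length at most doubles and grows by one with each block. Moves that
  consist of a single block are not counted.
\<close>

lemma block_strategy_length:
  assumes fin: "finite V" and "bs \<noteq> []" "block_list V bs" "set \<sigma> \<subseteq> contiguous_unions bs"
  shows "\<exists>\<sigma>'. set \<sigma>' \<subseteq> contiguous_unions bs \<and>
             length (filter (\<lambda>S. S \<notin> set bs) \<sigma>') \<le> 2 ^ (length bs - 1) - 1 \<and>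
             ip V x (strategy_op \<sigma> z) \<le> ip V x (strategy_op \<sigma>' z)"
  using assms(2-)
proof (induction bs arbitrary: \<sigma> x z)
  case (Cons b bs)
  note bl = Cons.prems(2)
  show ?case
  proof (cases "bs = []")
    case True
    then have "filter (\<lambda>S. S \<notin> set (b # bs)) \<sigma> = []"
      using Cons.prems(3) by (auto simp: filter_empty_conv contiguous_unions_Cons prefix_unions_Cons)
    then show ?thesis using Cons.prems(3) by (metis le0 list.size(3) order_refl)
  next
    case False
    then have IH: "\<exists>\<sigma>'. set \<sigma>' \<subseteq> contiguous_unions bs \<and>
             length (filter (\<lambda>S. S \<notin> set (b # bs)) \<sigma>') \<le> 2 ^ (length bs - 1) - 1 \<and>
             ip V x (strategy_op \<tau> z) \<le> ip V x (strategy_op \<sigma>' z)"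
      if "set \<tau> \<subseteq> contiguous_unions bs" for \<tau> x z
    proof -
      have "length (filter (\<lambda>S. S \<notin> set (b # bs)) \<upsilon>) \<le> length (filter (\<lambda>S. S \<notin> set bs) \<upsilon>)" for \<upsilon>
        by (induction \<upsilon>) auto
      then show ?thesis
        using Cons.IH[OF False _ that, of x z] bl by (meson block_list_Cons order_trans)
    qed
    have tl: "contiguous_unions bs \<subseteq> contiguous_unions (b # bs)" by (auto simp: contiguous_unions_Cons)
    have inV: "T \<subseteq> V" if "T \<in> contiguous_unions bs" for T
      using that tl contiguous_unions_in[OF bl] by blast
    have pow: "(2::nat) ^ (length (b # bs) - 1) = 2 * 2 ^ (length bs - 1)" "1 \<le> (2::nat) ^ (length bs - 1)"
      using False by (cases bs) auto
    obtain \<tau> where \<tau>: "set \<tau> \<subseteq> contiguous_unions (b # bs)"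
      "length (filter (\<lambda>S. b \<subseteq> S) \<tau>) \<le> 1"
      "ip V x (strategy_op \<sigma> z) \<le> ip V x (strategy_op \<tau> z)"
      using at_most_one_first_block_move[OF fin Cons.prems, of x z] by auto
    show ?thesis
      using \<tau>(2)
    proof (cases rule: filter_at_most_one)
      case 1
      then have "set \<tau> \<subseteq> contiguous_unions bs"
        using \<tau>(1) first_block_subset_iff(2)[OF bl] by blast
      from IH[OF this, of x z] obtain \<sigma>' where "set \<sigma>' \<subseteq> contiguous_unions bs"
        "length (filter (\<lambda>S. S \<notin> set (b # bs)) \<sigma>') \<le> 2 ^ (length bs - 1) - 1"
        "ip V x (strategy_op \<tau> z) \<le> ip V x (strategy_op \<sigma>' z)" by blast
      then show ?thesis
        using tl \<tau>(3) pow by (intro exI[of _ \<sigma>']) auto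
    next
      case (2 \<alpha> T \<gamma>)
      have sub: "set \<alpha> \<subseteq> contiguous_unions bs" "set \<gamma> \<subseteq> contiguous_unions bs"
        using 2(1,3) \<tau>(1) first_block_subset_iff(2)[OF bl]
        by (auto simp: subset_iff)
      have T: "T \<in> contiguous_unions (b # bs)" "T \<subseteq> V" using 2 \<tau>(1) contiguous_unions_in[OF bl] by auto
      define x' where "x' = strategy_op (rev (T # \<gamma>)) x"
      obtain \<alpha>' where \<alpha>': "set \<alpha>' \<subseteq> contiguous_unions bs"
        "length (filter (\<lambda>S. S \<notin> set (b # bs)) \<alpha>') \<le> 2 ^ (length bs - 1) - 1"
        "ip V x' (strategy_op \<alpha> z) \<le> ip V x' (strategy_op \<alpha>' z)"
        using IH[OF sub(1)] by blast
      define z' where "z' = strategy_op (\<alpha>' @ [T]) z"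
      obtain \<gamma>' where \<gamma>': "set \<gamma>' \<subseteq> contiguous_unions bs"
        "length (filter (\<lambda>S. S \<notin> set (b # bs)) \<gamma>') \<le> 2 ^ (length bs - 1) - 1"
        "ip V x (strategy_op \<gamma> z') \<le> ip V x (strategy_op \<gamma>' z')"
        using IH[OF sub(2)] by blast
      have "S \<subseteq> V" if "S \<in> set (T # \<gamma>)" for S
        using that T(2) sub(2) inV by (auto simp: subset_iff)
      note seg = ip_strategy_segment[of V "T # \<gamma>" x "[]", OF fin this, folded x'_def]
      have "ip V x (strategy_op \<tau> z) = ip V x' (strategy_op \<alpha> z)"
        using seg[of \<alpha> z] by (simp add: 2(1))
      also note \<alpha>'(3)
      also have "ip V x' (strategy_op \<alpha>' z) = ip V x (strategy_op \<gamma> z')"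
        using seg[of \<alpha>' z] by (simp add: z'_def)
      also note \<gamma>'(3)
      finally have "ip V x (strategy_op \<tau> z) \<le> ip V x (strategy_op (\<alpha>' @ T # \<gamma>') z)"
        by (simp add: z'_def)
      moreover have "length (filter (\<lambda>S. S \<notin> set (b # bs)) (\<alpha>' @ T # \<gamma>'))
          \<le> length (filter (\<lambda>S. S \<notin> set (b # bs)) \<alpha>')
            + (1 + length (filter (\<lambda>S. S \<notin> set (b # bs)) \<gamma>'))"
        by simp
      then have "length (filter (\<lambda>S. S \<notin> set (b # bs)) (\<alpha>' @ T # \<gamma>')) \<le> 2 ^ (length (b # bs) - 1) - 1"
        using \<alpha>'(2) \<gamma>'(2) pow by linarith
      moreover have "set (\<alpha>' @ T # \<gamma>') \<subseteq> contiguous_unions (b # bs)"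
        using \<alpha>'(1) \<gamma>'(1) T tl by auto
      ultimately show ?thesis using \<tau>(3) by (meson order_trans)
    qed
  qed
qed simp

section \<open>Connected sets and deletable vertices\<close>

text \<open>
  A graph is represented by its symmetric adjacency relation \<open>E\<close>. Subgraphs are given by vertex
  sets only, since connectedness of a set depends only on \<open>E\<close> inside that set.
\<close>

locale symmetric_relation =
  fixes E :: "'v \<Rightarrow> 'v \<Rightarrow> bool"
  assumes sym: "E u v \<Longrightarrow> E v u"
begin

text \<open>
  Connectedness in terms of cuts: every proper nonempty part of \<open>S\<close> has an edge to the rest of
  \<open>S\<close>.
\<close>

definition conn :: "'v set \<Rightarrow> bool" where
  "conn S \<longleftrightarrow> S \<noteq> {} \<and> (\<forall>A. A \<noteq> {} \<and> A \<subset> S \<longrightarrow> (\<exists>u\<in>A. \<exists>v\<in>S - A. E u v))"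

text \<open>
  For connected \<open>V\<close> with at least two elements these are the vertices of \<open>V\<close> that are not cut
  vertices. No singleton has such a vertex, because the empty set is not connected.
\<close>

definition noncut :: "'v set \<Rightarrow> 'v \<Rightarrow> bool" where
  "noncut V a \<longleftrightarrow> a \<in> V \<and> conn (V - {a})"

lemma conn_crossing:
  assumes "conn S" "A \<noteq> {}" "A \<subset> S"
  obtains u v where "u \<in> A" "v \<in> S - A" "E u v"
  using assms unfolding conn_def by blast

lemma conn_nonempty: "conn S \<Longrightarrow> S \<noteq> {}"
  by (simp add: conn_def)

lemma conn_singleton: "conn {v}"
  unfolding conn_def by (auto simp: psubset_eq subset_singleton_iff)

lemma conn_insert:
  assumes S: "conn S" and u: "u \<in> S" "E u w"
  shows "conn (insert w S)"
proof (cases "w \<in> S")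
  case False
  show ?thesis
    unfolding conn_def
  proof (intro conjI allI impI)
    fix A assume A: "A \<noteq> {} \<and> A \<subset> insert w S"
    show "\<exists>p\<in>A. \<exists>q\<in>insert w S - A. E p q"
    proof (cases "A \<inter> S = {} \<or> S \<subseteq> A")
      case True
      then show ?thesis
      proof
        assume "A \<inter> S = {}"
        with A have "A = {w}" by auto
        then show ?thesis using u(1) sym[OF u(2)] False by auto
      next
        assume "S \<subseteq> A"
        with A have "w \<notin> A" by auto
        then show ?thesis using u \<open>S \<subseteq> A\<close> by auto
      qed
    next
      case False
      then have "A \<inter> S \<noteq> {}" "A \<inter> S \<subset> S" by auto
      with S obtain p q where "p \<in> A \<inter> S" "q \<in> S - A \<inter> S" "E p q" by (rule conn_crossing)
      then show ?thesis by blast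
    qed
  qed simp
qed (use S in \<open>simp add: insert_absorb\<close>)

lemma conn_delete_leaf:
  assumes S: "conn S" "a \<in> S" "S \<noteq> {a}" and leaf: "\<And>w. w \<in> S \<Longrightarrow> E a w \<Longrightarrow> w = u \<or> w = a"
  shows "conn (S - {a})"
  unfolding conn_def
proof (intro conjI allI impI)
  show "S - {a} \<noteq> {}" using S by auto
  fix A assume A: "A \<noteq> {} \<and> A \<subset> S - {a}"
  show "\<exists>p\<in>A. \<exists>q\<in>S - {a} - A. E p q"
  proof (cases "u \<in> A")
    case True
    have "insert a A \<noteq> {}" "insert a A \<subset> S" using A S by auto
    with S(1) obtain p q where "p \<in> insert a A" "q \<in> S - insert a A" "E p q" by (rule conn_crossing)
    then show ?thesis using leaf True by blast
  next
    case False
    have "A \<noteq> {}" "A \<subset> S" using A by auto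
    with S(1) obtain p q where pq: "p \<in> A" "q \<in> S - A" "E p q" by (rule conn_crossing)
    moreover have "q \<noteq> a" using pq sym leaf False A by blast
    ultimately show ?thesis by blast
  qed
qed

text \<open>
  A maximal connected set that contains \<open>a\<close> and avoids \<open>v\<close> has an edge to the rest of \<open>V\<close>, and
  by maximality this edge ends in \<open>v\<close>.
\<close>

lemma conn_maximal_avoiding:
  assumes fin: "finite V" and V: "conn V" "a \<in> V" "v \<in> V" "a \<noteq> v"
  obtains S where "conn S" "a \<in> S" "S \<subseteq> V - {v}" "conn (insert v S)"
proof -
  let ?P = "\<lambda>S. conn S \<and> a \<in> S \<and> S \<subseteq> V - {v}"
  have "?P {a}" using V conn_singleton by auto
  moreover have "\<forall>S. ?P S \<longrightarrow> card S < Suc (card V)"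
    using fin by (auto intro!: le_imp_less_Suc card_mono)
  ultimately obtain S where S: "?P S" and max: "\<And>T. ?P T \<Longrightarrow> card T \<le> card S"
    using ex_has_greatest_nat[of ?P "{a}" card "Suc (card V)"] by blast
  have "S \<subset> V" using S V by auto
  then obtain p q where pq: "p \<in> S" "q \<in> V - S" "E p q"
    using V(1) S by (metis conn_crossing empty_iff)
  have ins: "conn (insert q S)" using S pq conn_insert by auto
  have "finite S" using S fin by (auto intro: finite_subset)
  then have "\<not> ?P (insert q S)" using max[of "insert q S"] pq by auto
  then have "q = v" using ins S pq by auto
  then show ?thesis using that S ins by blast
qed

text \<open>
  A maximal connected proper subset of \<open>V\<close> lacks exactly one vertex.
\<close>

lemma noncut_exists:
  assumes fin: "finite V" and V: "conn V" "2 \<le> card V"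
  obtains w where "noncut V w"
proof -
  obtain a where a: "a \<in> V" using V by (auto simp: conn_def)
  let ?P = "\<lambda>S. conn S \<and> S \<subset> V"
  have "?P {a}" using V a conn_singleton by auto
  moreover have "\<forall>S. ?P S \<longrightarrow> card S < Suc (card V)"
    using fin by (auto intro!: le_imp_less_Suc card_mono)
  ultimately obtain S where S: "?P S" and max: "\<And>T. ?P T \<Longrightarrow> card T \<le> card S"
    using ex_has_greatest_nat[of ?P "{a}" card "Suc (card V)"] by blast
  obtain p q where pq: "p \<in> S" "q \<in> V - S" "E p q"
    using V(1) S conn_nonempty conn_crossing by metis
  have "finite S" using S fin by (auto intro: finite_subset)
  then have "\<not> ?P (insert q S)" using max[of "insert q S"] pq by auto
  moreover have "conn (insert q S)" using S pq conn_insert by auto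
  ultimately have "insert q S = V" using S pq by auto
  then have "V - {q} = S" using pq by auto
  then show ?thesis using that[of q] S pq by (auto simp: noncut_def)
qed

text \<open>
  A vertex whose deletion keeps \<open>V - {a}\<close> connected can also be deleted from \<open>V\<close>, unless it is
  the only neighbour of \<open>a\<close>.
\<close>

lemma noncut_extend:
  assumes "noncut (V - {a}) p" "a \<in> V" "w \<in> V - {a}" "w \<noteq> p" "E a w"
  shows "noncut V p"
proof -
  have "conn (insert a (V - {a} - {p}))"
    using assms sym[OF assms(5)] by (intro conn_insert[of _ w]) (auto simp: noncut_def)
  moreover have "insert a (V - {a} - {p}) = V - {p}"
    using assms by (auto simp: noncut_def)
  ultimately show ?thesis using assms by (auto simp: noncut_def)
qed

text \<open>
  An enumeration of the vertices of a path from one end to the other, characterised by its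
  connected sets: they are the sets of contiguous entries.
\<close>

definition path_order :: "'v list \<Rightarrow> bool" where
  "path_order vs \<longleftrightarrow> distinct vs \<and>
     (\<forall>S\<subseteq>set vs. conn S \<longleftrightarrow> (\<exists>l m r. vs = l @ m @ r \<and> m \<noteq> [] \<and> S = set m))"

lemma path_order_conn_iff:
  "path_order vs \<Longrightarrow> S \<subseteq> set vs \<Longrightarrow>
     conn S \<longleftrightarrow> (\<exists>l m r. vs = l @ m @ r \<and> m \<noteq> [] \<and> S = set m)"
  unfolding path_order_def by blast

lemma path_order_distinct: "path_order vs \<Longrightarrow> distinct vs"
  unfolding path_order_def by blast

lemma path_order_connD:
  assumes "path_order vs" "S \<subseteq> set vs" "conn S"
  obtains l m r where "vs = l @ m @ r" "m \<noteq> []" "S = set m"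
proof -
  have "\<exists>l m r. vs = l @ m @ r \<and> m \<noteq> [] \<and> S = set m"
    by (rule iffD1[OF path_order_conn_iff[OF assms(1,2)] assms(3)])
  then show ?thesis by (elim exE conjE) (rule that)
qed

lemma path_order_connI:
  assumes "path_order (l @ m @ r)" "m \<noteq> []"
  shows "conn (set m)"
proof -
  have sub: "set m \<subseteq> set (l @ m @ r)" by auto
  have "\<exists>l' m' r'. l @ m @ r = l' @ m' @ r' \<and> m' \<noteq> [] \<and> set m = set m'"
    by (rule exI[of _ l], rule exI[of _ m], rule exI[of _ r], simp add: assms(2))
  then show ?thesis by (rule iffD2[OF path_order_conn_iff[OF assms(1) sub]])
qed

lemma path_orderI:
  assumes "distinct vs"
    and "\<And>S. S \<subseteq> set vs \<Longrightarrow> conn S \<longleftrightarrow> (\<exists>l m r. vs = l @ m @ r \<and> m \<noteq> [] \<and> S = set m)"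
  shows "path_order vs"
  unfolding path_order_def by (intro conjI allI impI assms)

lemma path_order_singleton: "path_order [v]"
proof -
  have "conn S \<longleftrightarrow> (\<exists>l m r. [v] = l @ m @ r \<and> m \<noteq> [] \<and> S = set m)" if "S \<subseteq> {v}" for S
  proof -
    consider "S = {}" | "S = {v}" using \<open>S \<subseteq> {v}\<close> by auto
    then show ?thesis
    proof cases
      case 1
      then show ?thesis using conn_nonempty by auto
    next
      case 2
      have "\<exists>l m r. [v] = l @ m @ r \<and> m \<noteq> [] \<and> S = set m"
        by (intro exI[of _ "[]"] exI[of _ "[v]"]) (simp add: 2)
      moreover have "conn S" using 2 conn_singleton by simp
      ultimately show ?thesis by blast
    qed
  qed
  then show ?thesis by (intro path_orderI) simp_all
qed

lemma path_order_rev: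
  assumes "path_order vs"
  shows "path_order (rev vs)"
proof -
  have rev: "\<exists>l m r. rev us = l @ m @ r \<and> m \<noteq> [] \<and> S = set m"
    if us: "\<exists>l m r. us = l @ m @ r \<and> m \<noteq> [] \<and> S = set m" for us S
  proof -
    from us obtain l m r where "us = l @ m @ r" "m \<noteq> []" "S = set m" by blast
    then have "rev us = rev r @ rev m @ rev l \<and> rev m \<noteq> [] \<and> S = set (rev m)" by simp
    then show ?thesis by (intro exI)
  qed
  show ?thesis
  proof (rule path_orderI)
    show "distinct (rev vs)" using path_order_distinct[OF assms] by simp
  next
    fix S assume "S \<subseteq> set (rev vs)"
    then have "S \<subseteq> set vs" by simp
    have "(\<exists>l m r. vs = l @ m @ r \<and> m \<noteq> [] \<and> S = set m) \<longleftrightarrow>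
          (\<exists>l m r. rev vs = l @ m @ r \<and> m \<noteq> [] \<and> S = set m)"
    proof
      show "\<exists>l m r. rev vs = l @ m @ r \<and> m \<noteq> [] \<and> S = set m"
        if "\<exists>l m r. vs = l @ m @ r \<and> m \<noteq> [] \<and> S = set m"
        using that by (rule rev)
      show "\<exists>l m r. vs = l @ m @ r \<and> m \<noteq> [] \<and> S = set m"
        if "\<exists>l m r. rev vs = l @ m @ r \<and> m \<noteq> [] \<and> S = set m"
        using rev[OF that] unfolding rev_rev_ident .
    qed
    with path_order_conn_iff[OF assms \<open>S \<subseteq> set vs\<close>]
    show "conn S \<longleftrightarrow> (\<exists>l m r. rev vs = l @ m @ r \<and> m \<noteq> [] \<and> S = set m)"
      by (rule trans)
  qed
qed

lemma path_order_Cons: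
  assumes vs: "path_order vs" "vs \<noteq> []" and a: "a \<notin> set vs" "E a (hd vs)"
    and leaf: "\<And>w. w \<in> set vs \<Longrightarrow> E a w \<Longrightarrow> w = hd vs"
  shows "path_order (a # vs)"
proof -
  have "conn S \<longleftrightarrow> (\<exists>l m r. a # vs = l @ m @ r \<and> m \<noteq> [] \<and> S = set m)"
    if S: "S \<subseteq> set (a # vs)" for S
  proof
    assume conn: "conn S"
    consider "a \<notin> S" | "S = {a}" | "a \<in> S" "S \<noteq> {a}" by blast
    then show "\<exists>l m r. a # vs = l @ m @ r \<and> m \<noteq> [] \<and> S = set m"
    proof cases
      case 1
      then have "S \<subseteq> set vs" using S by auto
      from path_order_connD[OF vs(1) this conn]
      obtain l m r where "vs = l @ m @ r" "m \<noteq> []" "S = set m" by blast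
      then show ?thesis by (intro exI[of _ "a # l"] exI[of _ m] exI[of _ r]) simp
    next
      case 2
      then show ?thesis by (intro exI[of _ "[]"] exI[of _ "[a]"] exI[of _ vs]) simp
    next
      case 3
      have sub: "S - {a} \<subseteq> set vs" using S unfolding list.set by blast
      have "{a} \<noteq> {}" "{a} \<subset> S" using 3 by auto
      with conn obtain p q where "p \<in> {a}" "q \<in> S - {a}" "E p q" by (rule conn_crossing)
      then have "E a q" "q \<in> S - {a}" by simp_all
      moreover from this have "q = hd vs" using leaf[OF subsetD[OF sub]] by simp
      ultimately have hd: "hd vs \<in> S - {a}" by simp
      have "conn (S - {a})"
        using conn 3
      proof (rule conn_delete_leaf)
        fix w assume "w \<in> S" "E a w"
        then show "w = hd vs \<or> w = a"
          using leaf[OF subsetD[OF sub], of w] by (cases "w = a") simp_all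
      qed
      with sub obtain l m r where m: "vs = l @ m @ r" "m \<noteq> []" "S - {a} = set m"
        by (rule path_order_connD[OF vs(1)])
      have "l = []"
      proof (rule ccontr)
        assume "l \<noteq> []"
        then have "hd vs \<in> set l" using m by simp
        moreover have "distinct vs" using path_order_distinct[OF vs(1)] .
        ultimately show False using hd m by auto
      qed
      then have "a # vs = [] @ (a # m) @ r" using m(1) by simp
      moreover have "S = set (a # m)" using m(3) 3(1) by auto
      ultimately show ?thesis by blast
    qed
  next
    assume "\<exists>l m r. a # vs = l @ m @ r \<and> m \<noteq> [] \<and> S = set m"
    then obtain l m r where m: "a # vs = l @ m @ r" "m \<noteq> []" "S = set m" by blast
    show "conn S"
    proof (cases l)
      case Nil
      then obtain m' where m': "m = a # m'" "vs = m' @ r" using m by (cases m) auto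
      show ?thesis
      proof (cases "m' = []")
        case True
        then show ?thesis using m(3) m'(1) conn_singleton by simp
      next
        case False
        then have "conn (set m')" using path_order_connI[of "[]" m' r] vs(1) m' by simp
        then have "conn (insert a (set m'))"
          using False m' sym[OF a(2)] by (intro conn_insert[of _ "hd vs"]) auto
        then show ?thesis using m(3) m'(1) by simp
      qed
    next
      case (Cons b l')
      then have "vs = l' @ m @ r" using m by simp
      then show ?thesis using path_order_connI[of l' m r] vs(1) m(2,3) by simp
    qed
  qed
  moreover have "distinct (a # vs)" using path_order_distinct[OF vs(1)] a(1) by simp
  ultimately show ?thesis by (rule path_orderI[rotated])
qed

text \<open>
  Delete a vertex \<open>a\<close> that leaves the rest connected. A deletable vertex of the rest is
  deletable in \<open>V\<close> unless it is the only neighbour of \<open>a\<close>, so the rest again has no three of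
  them and is a path by induction. Both of its ends are deletable in the rest, so one of them is
  the only neighbour of \<open>a\<close>.
\<close>

lemma path_order_exists:
  assumes "finite V" "conn V"
    and "\<not> (\<exists>a b c. distinct [a, b, c] \<and> noncut V a \<and> noncut V b \<and> noncut V c)"
  shows "\<exists>vs. set vs = V \<and> path_order vs"
  using assms
proof (induction "card V" arbitrary: V rule: less_induct)
  case (less V)
  note fin = less.prems(1) and V = less.prems(2)
  have no3: "False" if "noncut V p" "noncut V q" "noncut V r" "distinct [p, q, r]" for p q r
    using less.prems(3) that by blast
  show ?case
  proof (cases "2 \<le> card V")
    case False
    moreover have "card V \<noteq> 0" using fin conn_nonempty[OF V] by simp
    ultimately have "card V = 1" by simp
    then obtain v where "V = {v}" by (auto simp: card_1_singleton_iff)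
    then show ?thesis using path_order_singleton by (intro exI[of _ "[v]"]) simp
  next
    case True
    then obtain a where a: "noncut V a" using noncut_exists fin V by blast
    then have aV: "a \<in> V" and V': "conn (V - {a})" by (auto simp: noncut_def)
    have "{a} \<noteq> {}" "{a} \<subset> V" using aV True by auto
    with V obtain a' u where "a' \<in> {a}" "u \<in> V - {a}" "E a' u" by (rule conn_crossing)
    then have u: "u \<in> V - {a}" "E a u" by auto
    have lift: "noncut V p \<or> (\<forall>w\<in>V - {a}. E a w \<longrightarrow> w = p)" if "noncut (V - {a}) p" for p
      using noncut_extend[OF that aV] by blast
    have ne: "p \<noteq> a" if "noncut (V - {a}) p" for p using that by (auto simp: noncut_def)
    have "\<not> (\<exists>p q r. distinct [p, q, r] \<and> noncut (V - {a}) p \<and> noncut (V - {a}) q \<and> noncut (V - {a}) r)"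
    proof (intro notI, elim exE conjE)
      fix p q r
      assume pqr: "distinct [p, q, r]" and nc: "noncut (V - {a}) p" "noncut (V - {a}) q" "noncut (V - {a}) r"
      have "noncut V p \<and> noncut V q \<or> noncut V p \<and> noncut V r \<or> noncut V q \<and> noncut V r"
        using lift[OF nc(1)] lift[OF nc(2)] lift[OF nc(3)] u pqr by auto
      then show False
        using no3[OF a, of p q] no3[OF a, of p r] no3[OF a, of q r] ne[OF nc(1)] ne[OF nc(2)] ne[OF nc(3)] pqr
        by auto
    qed
    from less.hyps[OF card_Diff1_less[OF fin aV] finite_Diff[OF fin] V' this]
    obtain vs where vs: "set vs = V - {a}" "path_order vs" by blast
    have order_nonempty: "ws \<noteq> []" if ws: "set ws = V - {a}" for ws
    proof
      assume "ws = []"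
      with ws have "V - {a} = {}" by simp
      then show False using conn_nonempty[OF V'] by simp
    qed
    note nonempty = order_nonempty[OF vs(1)]
    have dist: "distinct vs" using path_order_distinct[OF vs(2)] .
    have attach: "\<exists>ws. set ws = V \<and> path_order ws"
      if ws: "set ws = V - {a}" "path_order ws" "\<forall>w\<in>V - {a}. E a w \<longrightarrow> w = hd ws" for ws
    proof -
      have "ws \<noteq> []" using order_nonempty ws(1) .
      moreover have "a \<notin> set ws" using ws(1) by simp
      moreover have "E a (hd ws)" using bspec[OF ws(3) u(1)] u(2) by simp
      moreover have "w = hd ws" if "w \<in> set ws" "E a w" for w
        using bspec[OF ws(3)] ws(1) that by simp
      ultimately have "path_order (a # ws)" by (rule path_order_Cons[OF ws(2)])
      moreover have "set (a # ws) = V" using ws(1) aV by auto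
      ultimately show ?thesis by blast
    qed
    have "(\<forall>w\<in>V - {a}. E a w \<longrightarrow> w = hd vs) \<or> (\<forall>w\<in>V - {a}. E a w \<longrightarrow> w = last vs)"
    proof (cases "tl vs = []")
      case True
      then obtain v where "vs = [v]" using nonempty by (cases vs) auto
      then show ?thesis using vs(1) by auto
    next
      case False
      have bl: "butlast vs \<noteq> []" using False nonempty by (cases vs) auto
      have "conn (set (tl vs))"
        using path_order_connI[of "[hd vs]" "tl vs" "[]"] vs(2) False nonempty by simp
      moreover have "conn (set (butlast vs))"
        using path_order_connI[of "[]" "butlast vs" "[last vs]"] vs(2) bl nonempty by simp
      moreover have "set (tl vs) = V - {a} - {hd vs}"
        using dist nonempty vs(1)[symmetric] by (cases vs) auto
      moreover have "set (butlast vs) = V - {a} - {last vs}"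
      proof -
        have "set vs = set (butlast vs @ [last vs])" "distinct (butlast vs @ [last vs])"
          using dist nonempty by simp_all
        then have "set vs = insert (last vs) (set (butlast vs))" "last vs \<notin> set (butlast vs)"
          by simp_all
        then show ?thesis using vs(1) by auto
      qed
      ultimately have nc: "noncut (V - {a}) (hd vs)" "noncut (V - {a}) (last vs)"
        using nonempty vs(1)[symmetric] by (simp_all add: noncut_def)
      have "hd vs \<noteq> last vs"
        using dist False nonempty by (cases vs) auto
      then have "\<not> (noncut V (hd vs) \<and> noncut V (last vs))"
        using no3[OF a, of "hd vs" "last vs"] ne[OF nc(1)] ne[OF nc(2)] by auto
      then show ?thesis using lift[OF nc(1)] lift[OF nc(2)] by blast
    qed
    then show ?thesis
    proof
      assume "\<forall>w\<in>V - {a}. E a w \<longrightarrow> w = hd vs"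
      then show ?thesis using attach vs by blast
    next
      assume "\<forall>w\<in>V - {a}. E a w \<longrightarrow> w = last vs"
      then show ?thesis
        using attach[of "rev vs"] vs path_order_rev nonempty by (simp add: hd_rev)
    qed
  qed
qed

end

section \<open>Contraction by moves that cross every cut\<close>

lemma strategy_op_energy_le_invariant:
  assumes "finite W" "\<And>S. S \<in> set \<rho> \<Longrightarrow> S \<subseteq> W \<or> S \<inter> W = {}"
  shows "ip W (strategy_op \<rho> z) (strategy_op \<rho> z) \<le> ip W z z"
  using assms(2)
proof (induction \<rho> arbitrary: z)
  case (Cons S \<rho>)
  have "ip W (avg_op S z) (avg_op S z) \<le> ip W z z"
  proof (cases "S \<subseteq> W")
    case True
    then show ?thesis using assms(1) by (rule avg_op_energy_le[rotated])
  next
    case False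
    then have "S \<inter> W = {}" using Cons.prems[of S] by simp
    then have "ip W (avg_op S z) (avg_op S z) = ip W z z"
      by (intro ip_cong) (auto intro!: avg_op_notin)
    then show ?thesis by simp
  qed
  moreover have "ip W (strategy_op \<rho> (avg_op S z)) (strategy_op \<rho> (avg_op S z))
      \<le> ip W (avg_op S z) (avg_op S z)"
    using Cons.prems by (intro Cons.IH) simp
  ultimately show ?case by simp
qed simp

lemma sum_square_le:
  fixes A B \<alpha> \<beta> X Y :: real
  assumes "A\<^sup>2 \<le> \<alpha> * X" "B\<^sup>2 \<le> \<beta> * Y" "0 \<le> \<alpha>" "0 \<le> \<beta>" "0 \<le> X" "0 \<le> Y"
  shows "(A + B)\<^sup>2 \<le> (\<alpha> + \<beta>) * (X + Y)"
proof -
  have "(2 * (A * B))\<^sup>2 = 4 * (A\<^sup>2 * B\<^sup>2)" by (simp add: power_mult_distrib)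
  also have "\<dots> \<le> 4 * ((\<alpha> * X) * (\<beta> * Y))"
    by (intro mult_left_mono mult_mono assms mult_nonneg_nonneg zero_le_power2) simp_all
  also have "\<dots> = 4 * ((\<alpha> * Y) * (\<beta> * X))" by simp
  also have "\<dots> = (\<alpha> * Y + \<beta> * X)\<^sup>2 - (\<alpha> * Y - \<beta> * X)\<^sup>2"
    by (simp add: power2_eq_square algebra_simps)
  also have "\<dots> \<le> (\<alpha> * Y + \<beta> * X)\<^sup>2" by simp
  finally have "2 * (A * B) \<le> \<alpha> * Y + \<beta> * X"
    by (rule power2_le_imp_le) (simp add: assms)
  moreover have "(A + B)\<^sup>2 = A\<^sup>2 + B\<^sup>2 + 2 * (A * B)" by (simp add: power2_sum)
  moreover have "(\<alpha> + \<beta>) * (X + Y) = \<alpha> * X + \<beta> * Y + (\<alpha> * Y + \<beta> * X)"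
    by (simp add: algebra_simps)
  ultimately show ?thesis using assms(1,2) by linarith
qed

text \<open>
  The sets of \<open>\<rho>\<close> are the edges of a hypergraph on \<open>V\<close>, and \<open>\<kappa> v\<close> is the component of \<open>v\<close> (or a
  union of components). On each component the values of \<open>z\<close> before and after \<open>\<rho>\<close> lie in an
  interval whose squared length is at most \<open>2 * (card (\<kappa> v) - 1)\<close> times the energy \<open>\<Sum> z\<^sup>2\<close> that
  the component has lost. The end points are indexed by the component, so that they agree for
  all its vertices.
\<close>

definition component_bounds ::
    "'v set \<Rightarrow> 'v set list \<Rightarrow> ('v \<Rightarrow> real) \<Rightarrow>
     ('v \<Rightarrow> 'v set) \<Rightarrow> ('v set \<Rightarrow> real) \<Rightarrow> ('v set \<Rightarrow> real) \<Rightarrow> bool" where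
  "component_bounds V \<rho> z \<kappa> lo hi \<longleftrightarrow> (\<forall>v\<in>V. v \<in> \<kappa> v \<and> \<kappa> v \<subseteq> V \<and> (\<forall>u\<in>\<kappa> v. \<kappa> u = \<kappa> v) \<and>
      (\<forall>S\<in>set \<rho>. v \<in> S \<longrightarrow> S \<subseteq> \<kappa> v) \<and>
      (\<forall>u\<in>\<kappa> v. lo (\<kappa> v) \<le> z u \<and> z u \<le> hi (\<kappa> v) \<and>
          lo (\<kappa> v) \<le> strategy_op \<rho> z u \<and> strategy_op \<rho> z u \<le> hi (\<kappa> v)) \<and>
      (hi (\<kappa> v) - lo (\<kappa> v))\<^sup>2 \<le> 2 * (real (card (\<kappa> v)) - 1) *
          (ip (\<kappa> v) z z - ip (\<kappa> v) (strategy_op \<rho> z) (strategy_op \<rho> z)))"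

lemma component_boundsD:
  assumes "component_bounds V \<rho> z \<kappa> lo hi" "v \<in> V"
  shows "v \<in> \<kappa> v" "\<kappa> v \<subseteq> V" "u \<in> \<kappa> v \<Longrightarrow> \<kappa> u = \<kappa> v"
    "S \<in> set \<rho> \<Longrightarrow> v \<in> S \<Longrightarrow> S \<subseteq> \<kappa> v"
    "u \<in> \<kappa> v \<Longrightarrow> lo (\<kappa> v) \<le> z u" "u \<in> \<kappa> v \<Longrightarrow> z u \<le> hi (\<kappa> v)"
    "u \<in> \<kappa> v \<Longrightarrow> lo (\<kappa> v) \<le> strategy_op \<rho> z u" "u \<in> \<kappa> v \<Longrightarrow> strategy_op \<rho> z u \<le> hi (\<kappa> v)"
    "(hi (\<kappa> v) - lo (\<kappa> v))\<^sup>2 \<le> 2 * (real (card (\<kappa> v)) - 1) *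
        (ip (\<kappa> v) z z - ip (\<kappa> v) (strategy_op \<rho> z) (strategy_op \<rho> z))"
proof -
  note * = bspec[OF iffD1[OF component_bounds_def assms(1)] assms(2)]
  show "v \<in> \<kappa> v" by (rule conjunct1[OF *])
  note * = conjunct2[OF *]
  show "\<kappa> v \<subseteq> V" by (rule conjunct1[OF *])
  note * = conjunct2[OF *]
  show "u \<in> \<kappa> v \<Longrightarrow> \<kappa> u = \<kappa> v" by (rule bspec[OF conjunct1[OF *]])
  note * = conjunct2[OF *]
  show "S \<in> set \<rho> \<Longrightarrow> v \<in> S \<Longrightarrow> S \<subseteq> \<kappa> v" by (rule mp[OF bspec[OF conjunct1[OF *]]])
  note * = conjunct2[OF *]
  note bounds = bspec[OF conjunct1[OF *]]
  show "u \<in> \<kappa> v \<Longrightarrow> lo (\<kappa> v) \<le> z u" "u \<in> \<kappa> v \<Longrightarrow> z u \<le> hi (\<kappa> v)"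
    "u \<in> \<kappa> v \<Longrightarrow> lo (\<kappa> v) \<le> strategy_op \<rho> z u" "u \<in> \<kappa> v \<Longrightarrow> strategy_op \<rho> z u \<le> hi (\<kappa> v)"
    using bounds[of u] by simp_all
  show "(hi (\<kappa> v) - lo (\<kappa> v))\<^sup>2 \<le> 2 * (real (card (\<kappa> v)) - 1) *
        (ip (\<kappa> v) z z - ip (\<kappa> v) (strategy_op \<rho> z) (strategy_op \<rho> z))"
    by (rule conjunct2[OF *])
qed

text \<open>
  By induction on the strategy. A further move \<open>S\<close> joins all components that it meets. Let \<open>\<kappa> i\<close>
  be the one that reaches highest and \<open>\<kappa> j\<close> the one that reaches lowest, with \<open>i\<close> and \<open>j\<close> in
  \<open>S\<close>. The new interval is no longer than the sum of the lengths for \<open>\<kappa> i\<close> and \<open>\<kappa> j\<close> and of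
  \<open>\<bar>y i - y j\<bar>\<close>, and the move loses energy at least \<open>(y i - y j)\<^sup>2 / 2\<close>. The Cauchy-Schwarz
  inequality adds up the three contributions.
\<close>

lemma component_bounds_exist:
  assumes fin: "finite V" and "\<forall>S\<in>set \<rho>. S \<subseteq> V \<and> S \<noteq> {}"
  shows "\<exists>\<kappa> lo hi. component_bounds V \<rho> z \<kappa> lo hi"
  using assms(2)
proof (induction \<rho> rule: rev_induct)
  case Nil
  have "component_bounds V [] z (\<lambda>v. {v}) (\<lambda>C. z (the_elem C)) (\<lambda>C. z (the_elem C))"
    by (simp add: component_bounds_def)
  then show ?case by (intro exI)
next
  case (snoc S \<rho>)
  then have SV: "S \<subseteq> V" and S_ne: "S \<noteq> {}" and \<rho>V: "\<forall>T\<in>set \<rho>. T \<subseteq> V \<and> T \<noteq> {}" by auto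
  from snoc.IH[OF \<rho>V] obtain \<kappa> lo hi where IH: "component_bounds V \<rho> z \<kappa> lo hi"
    by blast
  define y where "y = strategy_op \<rho> z"
  define y' where "y' = avg_op S y"
  have y': "strategy_op (\<rho> @ [S]) z = y'" by (simp add: y'_def y_def)
  note self = component_boundsD(1)[OF IH] and subV = component_boundsD(2)[OF IH]
    and cls = component_boundsD(3)[OF IH] and mv = component_boundsD(4)[OF IH]
    and bd = component_boundsD(5-8)[OF IH, folded y_def]
    and sq = component_boundsD(9)[OF IH, folded y_def]
  have finC: "finite (\<kappa> v)" if "v \<in> V" for v using subV[OF that] fin by (rule finite_subset)
  have disj: "\<kappa> w \<inter> \<kappa> v = {}" if wv: "w \<in> V" "v \<in> V" "w \<notin> \<kappa> v" for v w
  proof (rule ccontr)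
    assume "\<kappa> w \<inter> \<kappa> v \<noteq> {}"
    then obtain u where "u \<in> \<kappa> w" "u \<in> \<kappa> v" by blast
    then have "\<kappa> w = \<kappa> v" using cls[OF wv(1), of u] cls[OF wv(2), of u] by simp
    then show False using self[OF wv(1)] wv(3) by simp
  qed
  define C where "C = (\<Union>s\<in>S. \<kappa> s)"
  have SC: "S \<subseteq> C" using self SV by (auto simp: C_def)
  have CV: "C \<subseteq> V" using subV SV by (auto simp: C_def)
  have finS: "finite S" and finC': "finite C" using SV CV fin by (auto intro: finite_subset)
  have inC: "\<kappa> v \<subseteq> C" if "v \<in> C" for v using that cls SV unfolding C_def by blast
  have outC: "\<kappa> v \<inter> C = {}" if "v \<in> V" "v \<notin> C" for v
  proof (rule ccontr)
    assume "\<kappa> v \<inter> C \<noteq> {}"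
    then obtain u where u: "u \<in> \<kappa> v" "u \<in> C" by blast
    then have "\<kappa> v \<subseteq> C" using cls[OF that(1)] inC by blast
    then show False using self[OF that(1)] that(2) by blast
  qed
  have "Max ((\<lambda>s. hi (\<kappa> s)) ` S) \<in> (\<lambda>s. hi (\<kappa> s)) ` S"
    using finS S_ne by (intro Max_in) auto
  then obtain i where i: "i \<in> S" "hi (\<kappa> i) = Max ((\<lambda>s. hi (\<kappa> s)) ` S)" by auto
  have i_max: "hi (\<kappa> s) \<le> hi (\<kappa> i)" if "s \<in> S" for s
    using that finS unfolding i(2) by simp
  have "Min ((\<lambda>s. lo (\<kappa> s)) ` S) \<in> (\<lambda>s. lo (\<kappa> s)) ` S"
    using finS S_ne by (intro Min_in) auto
  then obtain j where j: "j \<in> S" "lo (\<kappa> j) = Min ((\<lambda>s. lo (\<kappa> s)) ` S)" by auto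
  have j_min: "lo (\<kappa> j) \<le> lo (\<kappa> s)" if "s \<in> S" for s
    using that finS unfolding j(2) by simp
  have ij: "i \<in> V" "j \<in> V" using i(1) j(1) SV by auto
  define HI LO where "HI = hi (\<kappa> i)" and "LO = lo (\<kappa> j)"
  have bdC: "LO \<le> z u" "z u \<le> HI" "LO \<le> y u" "y u \<le> HI" if "u \<in> C" for u
  proof -
    obtain s where s: "s \<in> S" "u \<in> \<kappa> s" using \<open>u \<in> C\<close> by (auto simp: C_def)
    then have "s \<in> V" using SV by auto
    from bd[OF this s(2)] i_max[OF s(1)] j_min[OF s(1)]
    show "LO \<le> z u" "z u \<le> HI" "LO \<le> y u" "y u \<le> HI" by (simp_all add: HI_def LO_def)
  qed
  have bdy': "LO \<le> y' u \<and> y' u \<le> HI" if "u \<in> C" for u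
  proof (cases "u \<in> S")
    case True
    have c: "real (card S) > 0" using finS S_ne by (simp add: card_gt_0_iff)
    have "(\<Sum>v\<in>S. y v) \<le> real (card S) * HI" "real (card S) * LO \<le> (\<Sum>v\<in>S. y v)"
      using bdC SC by (auto intro!: sum_bounded_above sum_bounded_below)
    then show ?thesis using True c by (simp add: y'_def avg_op_def field_simps)
  next
    case False
    then show ?thesis using bdC that by (simp add: y'_def avg_op_notin)
  qed
  have inv: "T \<subseteq> W \<or> T \<inter> W = {}"
    if W: "\<And>w. w \<in> W \<Longrightarrow> w \<in> V \<and> \<kappa> w \<subseteq> W" and "T \<in> set \<rho>" for T W
    using W mv[OF _ \<open>T \<in> set \<rho>\<close>] by blast
  have nonneg: "0 \<le> ip W z z - ip W y y"
    if W: "\<And>w. w \<in> W \<Longrightarrow> w \<in> V \<and> \<kappa> w \<subseteq> W" for W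
  proof -
    have "finite W" using W fin by (auto intro: finite_subset[of W V])
    then show ?thesis
      using strategy_op_energy_le_invariant[of W \<rho> z] inv[OF W] by (simp add: y_def)
  qed
  have clsW: "w \<in> V \<and> \<kappa> w \<subseteq> \<kappa> v" if "v \<in> V" "w \<in> \<kappa> v" for v w
    using subV[OF that(1)] cls[OF that] that by auto
  define D where "D W = ip W z z - ip W y y" for W
  define d where "d = y i - y j"
  have drop: "ip C y' y' \<le> ip C y y - d\<^sup>2 / 2"
    unfolding y'_def d_def using avg_op_energy_drop[OF finC' SC i(1) j(1), of y] .
  have Di: "0 \<le> D (\<kappa> i)" "0 \<le> D (\<kappa> j)" using nonneg clsW ij by (auto simp: D_def)
  have card1: "1 \<le> card (\<kappa> i)" "1 \<le> card (\<kappa> j)"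
    using self finC ij by (auto simp: Suc_le_eq card_gt_0_iff)
  have split: "D (A \<union> B) = D A + D B" if "finite A" "finite B" "A \<inter> B = {}" for A B
    using that by (simp add: D_def ip_disjoint_union)
  have split_C: "D C = D A + D (C - A)" if "A \<subseteq> C" for A
  proof -
    have "finite A" using that finC' by (rule finite_subset)
    then have "D (A \<union> (C - A)) = D A + D (C - A)" using finC' by (intro split) auto
    moreover have "A \<union> (C - A) = C" using that by auto
    ultimately show ?thesis by simp
  qed
  have main: "(HI - LO)\<^sup>2 \<le> 2 * (real (card C) - 1) * (D C + d\<^sup>2 / 2)"
  proof (cases "\<kappa> i = \<kappa> j")
    case True
    have sub: "\<kappa> i \<subseteq> C" using i(1) by (auto simp: C_def)
    have "0 \<le> D (C - \<kappa> i)"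
      unfolding D_def
    proof (rule nonneg)
      fix w assume w: "w \<in> C - \<kappa> i"
      then have "\<kappa> w \<inter> \<kappa> i = {}" using disj[of w i] ij CV by auto
      then show "w \<in> V \<and> \<kappa> w \<subseteq> C - \<kappa> i" using w inC CV by blast
    qed
    then have "D (\<kappa> i) \<le> D C"
      using split_C[OF sub] by simp
    then have "D (\<kappa> i) \<le> D C + d\<^sup>2 / 2" by (rule order_trans) simp
    moreover have "card (\<kappa> i) \<le> card C" using sub finC' by (rule card_mono[rotated])
    moreover have "(HI - LO)\<^sup>2 \<le> 2 * (real (card (\<kappa> i)) - 1) * D (\<kappa> i)"
      using sq[OF ij(1)] True by (simp add: HI_def LO_def D_def)
    moreover have "2 * (real (card (\<kappa> i)) - 1) * D (\<kappa> i) \<le> 2 * (real (card C) - 1) * (D C + d\<^sup>2 / 2)"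
      using calculation card1 Di by (intro mult_mono) auto
    ultimately show ?thesis by linarith
  next
    case False
    have "i \<notin> \<kappa> j" using False cls[OF ij(2), of i] by auto
    then have dis: "\<kappa> i \<inter> \<kappa> j = {}" by (rule disj[OF ij])
    have sub: "\<kappa> i \<union> \<kappa> j \<subseteq> C" using i(1) j(1) by (auto simp: C_def)
    have "0 \<le> D (C - (\<kappa> i \<union> \<kappa> j))"
      unfolding D_def
    proof (rule nonneg)
      fix w assume w: "w \<in> C - (\<kappa> i \<union> \<kappa> j)"
      then have "\<kappa> w \<inter> \<kappa> i = {}" "\<kappa> w \<inter> \<kappa> j = {}"
        using disj[of w i] disj[of w j] ij CV by auto
      then show "w \<in> V \<and> \<kappa> w \<subseteq> C - (\<kappa> i \<union> \<kappa> j)" using w inC CV by blast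
    qed
    then have "D (\<kappa> i \<union> \<kappa> j) \<le> D C"
      using split_C[OF sub] by simp
    then have D: "D (\<kappa> i) + D (\<kappa> j) \<le> D C" using split[of "\<kappa> i" "\<kappa> j"] dis finC ij by simp
    have "card (\<kappa> i \<union> \<kappa> j) \<le> card C" using sub finC' by (rule card_mono[rotated])
    then have c: "real (card (\<kappa> i)) + real (card (\<kappa> j)) \<le> real (card C)"
      using dis finC ij by (simp add: card_Un_disjoint)
    define a b where "a = hi (\<kappa> i) - lo (\<kappa> i)" and "b = hi (\<kappa> j) - lo (\<kappa> j)"
    have "(a + b)\<^sup>2 \<le> ((real (card (\<kappa> i)) - 1) + (real (card (\<kappa> j)) - 1)) * (2 * D (\<kappa> i) + 2 * D (\<kappa> j))"
      using sq[OF ij(1)] sq[OF ij(2)] card1 Di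
      by (intro sum_square_le) (auto simp: a_def b_def D_def algebra_simps)
    then have "(a + b + \<bar>d\<bar>)\<^sup>2 \<le> ((real (card (\<kappa> i)) - 1) + (real (card (\<kappa> j)) - 1) + 1) *
        ((2 * D (\<kappa> i) + 2 * D (\<kappa> j)) + d\<^sup>2)"
      by (rule sum_square_le) (use card1 Di in auto)
    moreover have "\<dots> \<le> (real (card C) - 1) * (2 * (D C + d\<^sup>2 / 2))"
      using c D card1 Di by (intro mult_mono) auto
    moreover have "(HI - LO)\<^sup>2 \<le> (a + b + \<bar>d\<bar>)\<^sup>2"
    proof (rule power_mono)
      show "HI - LO \<le> a + b + \<bar>d\<bar>"
        using bd(3)[OF ij(1) self[OF ij(1)]] bd(4)[OF ij(2) self[OF ij(2)]]
        by (simp add: HI_def LO_def a_def b_def d_def)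
      show "0 \<le> HI - LO" using bdC(1,2)[OF subsetD[OF SC i(1)]] by linarith
    qed
    ultimately show ?thesis by (simp add: algebra_simps)
  qed
  have "real (card C) \<ge> 1" using SC S_ne finC' by (auto simp: Suc_le_eq card_gt_0_iff)
  then have "2 * (real (card C) - 1) * (D C + d\<^sup>2 / 2) \<le> 2 * (real (card C) - 1) * (ip C z z - ip C y' y')"
    using drop by (intro mult_left_mono) (auto simp: D_def)
  with main have final: "(HI - LO)\<^sup>2 \<le> 2 * (real (card C) - 1) * (ip C z z - ip C y' y')" by linarith
  define \<kappa>' where "\<kappa>' v = (if v \<in> C then C else \<kappa> v)" for v
  define lo' where "lo' W = (if W = C then LO else lo W)" for W
  define hi' where "hi' W = (if W = C then HI else hi W)" for W
  have "v \<in> \<kappa>' v \<and> \<kappa>' v \<subseteq> V \<and> (\<forall>u\<in>\<kappa>' v. \<kappa>' u = \<kappa>' v) \<and>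
    (\<forall>T\<in>set (\<rho> @ [S]). v \<in> T \<longrightarrow> T \<subseteq> \<kappa>' v) \<and>
    (\<forall>u\<in>\<kappa>' v. lo' (\<kappa>' v) \<le> z u \<and> z u \<le> hi' (\<kappa>' v) \<and> lo' (\<kappa>' v) \<le> y' u \<and> y' u \<le> hi' (\<kappa>' v)) \<and>
    (hi' (\<kappa>' v) - lo' (\<kappa>' v))\<^sup>2 \<le> 2 * (real (card (\<kappa>' v)) - 1) * (ip (\<kappa>' v) z z - ip (\<kappa>' v) y' y')"
    if v: "v \<in> V" for v
  proof (cases "v \<in> C")
    case True
    have "\<forall>T\<in>set (\<rho> @ [S]). v \<in> T \<longrightarrow> T \<subseteq> C" using mv[OF v] inC[OF True] SC by auto
    then show ?thesis using True CV bdC bdy' final by (auto simp: \<kappa>'_def lo'_def hi'_def)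
  next
    case False
    note out = outC[OF v False]
    have ne: "\<kappa> v \<noteq> C" using self[OF v] False by auto
    have "\<forall>u\<in>\<kappa> v. \<kappa>' u = \<kappa> v" using out cls[OF v] by (auto simp: \<kappa>'_def)
    moreover have "\<forall>T\<in>set (\<rho> @ [S]). v \<in> T \<longrightarrow> T \<subseteq> \<kappa> v" using mv[OF v] SC False by auto
    moreover have same: "y' u = y u" if "u \<in> \<kappa> v" for u
      using that out SC by (auto simp: y'_def intro!: avg_op_notin)
    moreover have "ip (\<kappa> v) y' y' = ip (\<kappa> v) y y" using same by (intro ip_cong)
    ultimately show ?thesis
      using False ne self[OF v] subV[OF v] bd[OF v] sq[OF v]
      by (simp add: \<kappa>'_def lo'_def hi'_def)
  qed
  then have "component_bounds V (\<rho> @ [S]) z \<kappa>' lo' hi'"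
    unfolding component_bounds_def y' by (rule ballI)
  then show ?case by (intro exI)
qed

text \<open>
  For a list \<open>\<rho>\<close> of subsets of \<open>V\<close> this means that the hypergraph on \<open>V\<close> with edges \<open>\<rho>\<close> is
  connected.
\<close>

definition crosses_every_cut :: "'v set \<Rightarrow> 'v set list \<Rightarrow> bool" where
  "crosses_every_cut V \<rho> \<longleftrightarrow> (\<forall>A. A \<noteq> {} \<and> A \<subset> V \<longrightarrow> (\<exists>S\<in>set \<rho>. S \<inter> A \<noteq> {} \<and> S - A \<noteq> {}))"

text \<open>
  The interval for the single component \<open>V\<close> bounds the spread of \<open>z\<close> by the lost energy. As \<open>z\<close>
  has mean zero, its energy is at most \<open>card V / 4\<close> times the squared spread, so a fixed
  proportion of it is lost.
\<close>

lemma crosses_every_cut_contracts: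
  assumes fin: "finite V" and sub: "\<forall>S\<in>set \<rho>. S \<subseteq> V \<and> S \<noteq> {}" and "V \<noteq> {}"
    and span: "crosses_every_cut V \<rho>" and zero: "(\<Sum>v\<in>V. z v) = 0"
  shows "ip V (strategy_op \<rho> z) (strategy_op \<rho> z) \<le> (1 - 2 / (real (card V))\<^sup>2) * ip V z z"
proof -
  define n where "n = real (card V)"
  have n: "1 \<le> n" using fin \<open>V \<noteq> {}\<close> by (simp add: n_def Suc_le_eq card_gt_0_iff)
  define E0 E1 where "E0 = ip V z z" and "E1 = ip V (strategy_op \<rho> z) (strategy_op \<rho> z)"
  obtain \<kappa> lo hi where K: "component_bounds V \<rho> z \<kappa> lo hi"
    using component_bounds_exist[OF fin sub] by blast
  obtain v where v: "v \<in> V" using \<open>V \<noteq> {}\<close> by blast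
  note K = component_boundsD[OF K]
  have "\<kappa> v = V"
  proof (rule ccontr)
    assume "\<kappa> v \<noteq> V"
    then have "\<kappa> v \<noteq> {} \<and> \<kappa> v \<subset> V" using K(1,2)[OF v] by auto
    from mp[OF spec[OF span[unfolded crosses_every_cut_def]] this]
    obtain S u where S: "S \<in> set \<rho>" "u \<in> S" "u \<in> \<kappa> v" "S - \<kappa> v \<noteq> {}" by auto
    then have "u \<in> V" using K(2)[OF v] by auto
    then have "S \<subseteq> \<kappa> u" using S(1,2) by (rule K(4))
    also have "\<kappa> u = \<kappa> v" using v S(3) by (rule K(3))
    finally show False using S(4) by auto
  qed
  define LO HI where "LO = lo V" and "HI = hi V"
  have b: "LO \<le> z u" "z u \<le> HI" if "u \<in> V" for u
    using K(5,6)[OF v, of u] that by (simp_all add: \<open>\<kappa> v = V\<close> LO_def HI_def)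
  have sq: "(HI - LO)\<^sup>2 \<le> 2 * (n - 1) * (E0 - E1)"
    using K(9)[OF v] by (simp add: \<open>\<kappa> v = V\<close> LO_def HI_def n_def E0_def E1_def)
  \<comment> \<open>Subtracting the midpoint only increases the energy of a vector of mean zero.\<close>
  define c where "c = (LO + HI) / 2"
  have "E0 \<le> E0 + n * c\<^sup>2" using n by simp
  also have "\<dots> = (\<Sum>u\<in>V. (z u - c)\<^sup>2)"
  proof -
    have "(\<Sum>u\<in>V. (z u - c)\<^sup>2) = (\<Sum>u\<in>V. z u * z u + c\<^sup>2 - 2 * c * z u)"
      by (intro sum.cong refl) (simp add: power2_eq_square algebra_simps)
    also have "\<dots> = E0 + n * c\<^sup>2 - 2 * c * (\<Sum>u\<in>V. z u)"
      by (simp add: sum.distrib sum_subtractf sum_distrib_left E0_def ip_def n_def)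
    finally show ?thesis using zero by simp
  qed
  also have "\<dots> \<le> n * ((HI - LO) / 2)\<^sup>2"
    unfolding n_def
  proof (rule sum_bounded_above)
    fix u assume "u \<in> V"
    then have "\<bar>z u - c\<bar> \<le> (HI - LO) / 2" using b[of u] by (simp add: c_def abs_le_iff field_simps)
    then show "(z u - c)\<^sup>2 \<le> ((HI - LO) / 2)\<^sup>2" by (metis abs_ge_zero power2_abs power_mono)
  qed
  also have "\<dots> = n / 4 * (HI - LO)\<^sup>2" by (simp add: power_divide)
  also have "\<dots> \<le> n / 4 * (2 * (n - 1) * (E0 - E1))" using sq n by (intro mult_left_mono) auto
  also have "\<dots> = n * (n - 1) / 2 * (E0 - E1)" by (simp add: field_simps)
  also have "\<dots> \<le> n\<^sup>2 / 2 * (E0 - E1)"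
    using strategy_op_energy_le[OF fin, of \<rho> z] sub n
    by (intro mult_right_mono) (auto simp: power2_eq_square E0_def E1_def)
  finally have "2 / n\<^sup>2 * E0 \<le> E0 - E1" using n by (simp add: field_simps)
  then show ?thesis by (simp add: n_def[symmetric] E0_def[symmetric] E1_def[symmetric] algebra_simps)
qed

section \<open>Replacing parts of a strategy\<close>

lemma q_seq_pos: "2 \<le> n \<Longrightarrow> 1 \<le> q_seq n"
proof -
  assume "2 \<le> n"
  then have "0 < log 2 (real n)" by simp
  then have "1 \<le> nat \<lceil>log 2 (real n)\<rceil>" by linarith
  then show ?thesis using \<open>2 \<le> n\<close> by (simp add: q_seq_def)
qed

lemma L_seq_double: "1 \<le> n \<Longrightarrow> 2 * L_seq n + 1 \<le> L_seq (Suc n)"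
proof (cases "n = 1")
  case False
  assume "1 \<le> n"
  with False have n: "3 \<le> Suc n" by simp
  have "2 * 1 * (L_seq n + 1) \<le> 2 * q_seq (Suc n) * (L_seq n + 1)"
    using q_seq_pos[of "Suc n"] n by (intro mult_le_mono) auto
  then show ?thesis using L_seq_rec[OF n] by simp
qed simp

lemma L_seq_mono:
  assumes "1 \<le> m" "m \<le> n"
  shows "L_seq m \<le> L_seq n"
  using assms(2)
proof (induction n rule: dec_induct)
  case (step n)
  then show ?case using L_seq_double[of n] assms(1) by linarith
qed simp

text \<open>
  The cost of acting separately on two sides of a cut, of sizes \<open>a\<close> and \<open>b\<close>.
\<close>

lemma L_seq_superadditive: "1 \<le> a \<Longrightarrow> 1 \<le> b \<Longrightarrow> L_seq a + L_seq b \<le> L_seq (a + b - 1)"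
proof (induction a b rule: linorder_wlog)
  case (le a b)
  show ?case
  proof (cases "a = 1")
    case False
    then have "2 \<le> a" using le by simp
    have "L_seq a + L_seq b \<le> 2 * L_seq b" using L_seq_mono[of a b] le by simp
    also have "\<dots> \<le> L_seq (Suc b)" using L_seq_double[of b] le by simp
    also have "\<dots> \<le> L_seq (a + b - 1)" using \<open>2 \<le> a\<close> le by (intro L_seq_mono) auto
    finally show ?thesis .
  qed simp
qed (simp add: add.commute)

lemma exponential_le_L_seq:
  assumes "1 \<le> n"
  shows "2 ^ (n - 1) - 1 \<le> L_seq n"
  using assms
proof (induction n rule: dec_induct)
  case (step n)
  have "(2::nat) ^ (Suc n - 1) = 2 * 2 ^ (n - 1)" using step.hyps by (cases n) auto
  then show ?case using step.IH L_seq_double[of n] step.hyps by simp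
qed simp

lemma strategy_op_cong_on:
  assumes "\<And>S. S \<in> set \<sigma> \<Longrightarrow> S \<subseteq> A \<or> S \<inter> A = {}" "\<And>v. v \<in> A \<Longrightarrow> z v = z' v" "v \<in> A"
  shows "strategy_op \<sigma> z v = strategy_op (filter (\<lambda>S. S \<subseteq> A) \<sigma>) z' v"
  using assms(1,2)
proof (induction \<sigma> arbitrary: z z')
  case (Cons S \<sigma>)
  show ?case
  proof (cases "S \<subseteq> A")
    case True
    have "(\<Sum>u\<in>S. z u) = (\<Sum>u\<in>S. z' u)" using True Cons.prems(2) by (intro sum.cong) auto
    then have "avg_op S z u = avg_op S z' u" if "u \<in> A" for u
      using that Cons.prems(2) by (simp add: avg_op_def)
    then have "strategy_op \<sigma> (avg_op S z) v = strategy_op (filter (\<lambda>S. S \<subseteq> A) \<sigma>) (avg_op S z') v"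
      using Cons.prems(1) by (intro Cons.IH) auto
    then show ?thesis using True by simp
  next
    case False
    then have "S \<inter> A = {}" using Cons.prems(1)[of S] by simp
    then have "avg_op S z u = z' u" if "u \<in> A" for u
      using that Cons.prems(2) by (subst avg_op_notin) auto
    then have "strategy_op \<sigma> (avg_op S z) v = strategy_op (filter (\<lambda>S. S \<subseteq> A) \<sigma>) z' v"
      using Cons.prems(1) by (intro Cons.IH) auto
    then show ?thesis using False by simp
  qed
qed (use assms(3) in simp)

lemma avg_op_delete_vertex:
  assumes "finite V" "a \<in> V" "(\<Sum>v\<in>V. z v) = 0" "v \<in> V"
  shows "avg_op (V - {a}) z v = (if v = a then z a else - z a / (real (card V) - 1))"
proof -
  have "(\<Sum>u\<in>V - {a}. z u) = - z a" using assms sum.remove[of V a z] by simp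
  moreover have "1 \<le> card V" using assms by (auto simp: Suc_le_eq card_gt_0_iff)
  then have "real (card (V - {a})) = real (card V) - 1" using assms by (simp add: of_nat_diff)
  ultimately show ?thesis using assms by (simp add: avg_op_def)
qed

context symmetric_relation
begin

text \<open>
  The sets over which a strategy inside \<open>V\<close> may average.
\<close>

definition moves :: "'v set \<Rightarrow> 'v set set" where
  "moves V = {S. S \<subseteq> V \<and> conn S}"

text \<open>
  The statement proved by induction: for every bilinear value, strategies of length at most \<open>L\<close>
  are as good as arbitrary ones.
\<close>

definition short_strategies :: "'v set \<Rightarrow> nat \<Rightarrow> bool" where
  "short_strategies V L \<longleftrightarrow> (\<forall>x z \<sigma>. set \<sigma> \<subseteq> moves V \<longrightarrow>
     (\<exists>\<sigma>'. set \<sigma>' \<subseteq> moves V \<and> length \<sigma>' \<le> L \<and>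
        ip V x (strategy_op \<sigma> z) \<le> ip V x (strategy_op \<sigma>' z)))"

lemma short_strategiesD:
  assumes "short_strategies V L" "set \<sigma> \<subseteq> moves V"
  obtains \<sigma>' where "set \<sigma>' \<subseteq> moves V" "length \<sigma>' \<le> L"
    "ip V x (strategy_op \<sigma> z) \<le> ip V x (strategy_op \<sigma>' z)"
  using assms unfolding short_strategies_def by blast

lemma movesD: "S \<in> moves V \<Longrightarrow> S \<subseteq> V" "S \<in> moves V \<Longrightarrow> S \<noteq> {}"
  by (auto simp: moves_def dest: conn_nonempty)

lemma moves_mono: "A \<subseteq> V \<Longrightarrow> moves A \<subseteq> moves V"
  by (auto simp: moves_def)

lemma path_short_strategies:
  assumes fin: "finite V" and V: "conn V"
    and no3: "\<not> (\<exists>a b c. distinct [a, b, c] \<and> noncut V a \<and> noncut V b \<and> noncut V c)"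
  shows "short_strategies V (2 ^ (card V - 1) - 1)"
  unfolding short_strategies_def
proof (intro allI impI)
  fix x z \<sigma> assume \<sigma>: "set \<sigma> \<subseteq> moves V"
  obtain vs where vs: "set vs = V" "path_order vs"
    using path_order_exists[OF fin V no3] by blast
  define bs where "bs = map (\<lambda>v. {v}) vs"
  have card: "length bs = card V"
    using path_order_distinct[OF vs(2)] vs(1) distinct_card by (fastforce simp: bs_def)
  have cu: "contiguous_unions bs = moves V"
  proof (intro subset_antisym subsetI)
    fix S assume "S \<in> contiguous_unions bs"
    then obtain l m r where m: "bs = l @ m @ r" "m \<noteq> []" "S = \<Union>(set m)"
      by (auto simp: contiguous_unions_def)
    then obtain l' m' r' where m': "vs = l' @ m' @ r'" "m = map (\<lambda>v. {v}) m'"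
      by (auto simp: bs_def map_eq_append_conv append_eq_map_conv)
    have "S = set m'" using m m' by auto
    moreover have "conn (set m')" using path_order_connI[of l' m' r'] vs(2) m m' by simp
    ultimately show "S \<in> moves V" using vs(1) m'(1) by (auto simp: moves_def)
  next
    fix S assume "S \<in> moves V"
    then have "S \<subseteq> set vs" "conn S" using vs(1) by (auto simp: moves_def)
    then obtain l m r where m: "vs = l @ m @ r" "m \<noteq> []" "S = set m"
      by (rule path_order_connD[OF vs(2)])
    let ?f = "map (\<lambda>v. {v})"
    have "bs = ?f l @ ?f m @ ?f r \<and> ?f m \<noteq> [] \<and> S = \<Union>(set (?f m))"
      using m by (auto simp: bs_def)
    then show "S \<in> contiguous_unions bs" unfolding contiguous_unions_def by blast
  qed
  have "block_list V bs"
    using path_order_distinct[OF vs(2)] vs(1)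
    by (auto simp: block_list_def bs_def sorted_wrt_map distinct_conv_nth sorted_wrt_iff_nth_less)
  moreover have "bs \<noteq> []" using vs(1) conn_nonempty[OF V] by (auto simp: bs_def)
  ultimately obtain \<tau> where \<tau>: "set \<tau> \<subseteq> moves V"
    "length (filter (\<lambda>S. S \<notin> set bs) \<tau>) \<le> 2 ^ (card V - 1) - 1"
    "ip V x (strategy_op \<sigma> z) \<le> ip V x (strategy_op \<tau> z)"
    using block_strategy_length[OF fin, of bs \<sigma> x z] \<sigma> by (auto simp: cu card)
  have "strategy_op (filter (\<lambda>S. S \<notin> set bs) \<tau>) z = strategy_op \<tau> z" for z
  proof (induction \<tau> arbitrary: z)
    case (Cons S \<tau>)
    have "avg_op S z = z" if "S \<in> set bs"
      using that by (auto simp: bs_def intro: avg_op_constant)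
    then show ?case using Cons by simp
  qed simp
  then show "\<exists>\<sigma>'. set \<sigma>' \<subseteq> moves V \<and> length \<sigma>' \<le> 2 ^ (card V - 1) - 1 \<and>
      ip V x (strategy_op \<sigma> z) \<le> ip V x (strategy_op \<sigma>' z)"
    using \<tau> by (intro exI[of _ "filter (\<lambda>S. S \<notin> set bs) \<tau>"]) auto
qed

text \<open>
  Moves that do not cross the cut \<open>A\<close> act independently on its two sides.
\<close>

lemma split_strategy:
  assumes fin: "finite V" and A: "A \<subseteq> V" and \<rho>: "set \<rho> \<subseteq> moves V"
    and side: "\<And>S. S \<in> set \<rho> \<Longrightarrow> S \<subseteq> A \<or> S \<inter> A = {}"
    and short: "short_strategies A La" "short_strategies (V - A) Lb"
  obtains \<rho>' where "set \<rho>' \<subseteq> moves V" "length \<rho>' \<le> La + Lb"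
    "ip V x (strategy_op \<rho> z) \<le> ip V x (strategy_op \<rho>' z)"
proof -
  define B where "B = V - A"
  have AB: "V = A \<union> B" "A \<inter> B = {}" "finite A" "finite B" "B \<subseteq> V"
    using A fin by (auto simp: B_def intro: finite_subset)
  have sideB: "S \<subseteq> B \<or> S \<inter> B = {}" if "S \<in> set \<rho>" for S
    using side[OF that] \<rho> that AB movesD(1)[of S V] by blast
  define \<rho>A \<rho>B where "\<rho>A = filter (\<lambda>S. S \<subseteq> A) \<rho>" and "\<rho>B = filter (\<lambda>S. S \<subseteq> B) \<rho>"
  have "set \<rho>A \<subseteq> moves A" "set \<rho>B \<subseteq> moves B" using \<rho> by (auto simp: \<rho>A_def \<rho>B_def moves_def)
  obtain \<sigma>A where \<sigma>A: "set \<sigma>A \<subseteq> moves A" "length \<sigma>A \<le> La"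
    "ip A x (strategy_op \<rho>A z) \<le> ip A x (strategy_op \<sigma>A z)"
    using short(1) \<open>set \<rho>A \<subseteq> moves A\<close> by (rule short_strategiesD)
  obtain \<sigma>B where \<sigma>B: "set \<sigma>B \<subseteq> moves B" "length \<sigma>B \<le> Lb"
    "ip B x (strategy_op \<rho>B z) \<le> ip B x (strategy_op \<sigma>B z)"
    using short(2)[folded B_def] \<open>set \<rho>B \<subseteq> moves B\<close> by (rule short_strategiesD)
  have "ip V x (strategy_op \<rho> z) = ip A x (strategy_op \<rho> z) + ip B x (strategy_op \<rho> z)"
    unfolding AB(1) using AB by (intro ip_disjoint_union) auto
  also have "ip A x (strategy_op \<rho> z) = ip A x (strategy_op \<rho>A z)"
    unfolding \<rho>A_def using strategy_op_cong_on[of \<rho> A z z, OF side] by (intro ip_cong) auto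
  also have "ip B x (strategy_op \<rho> z) = ip B x (strategy_op \<rho>B z)"
    unfolding \<rho>B_def using strategy_op_cong_on[of \<rho> B z z, OF sideB] by (intro ip_cong) auto
  also have "ip A x (strategy_op \<rho>A z) + ip B x (strategy_op \<rho>B z)
      \<le> ip A x (strategy_op \<sigma>A z) + ip B x (strategy_op \<sigma>B z)"
    using \<sigma>A(3) \<sigma>B(3) by (rule add_mono)
  also have "ip A x (strategy_op \<sigma>A z) = ip A x (strategy_op (\<sigma>A @ \<sigma>B) z)"
  proof (rule ip_cong)
    fix v assume v: "v \<in> A"
    have "strategy_op \<sigma>B (strategy_op \<sigma>A z) v = strategy_op \<sigma>A z v"
      using v \<sigma>B(1) AB(2) by (intro strategy_op_notin) (auto dest: movesD(1))
    then show "strategy_op \<sigma>A z v = strategy_op (\<sigma>A @ \<sigma>B) z v" by simp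
  qed simp
  also have "ip B x (strategy_op \<sigma>B z) = ip B x (strategy_op (\<sigma>A @ \<sigma>B) z)"
  proof (rule ip_cong)
    fix v assume v: "v \<in> B"
    have "strategy_op \<sigma>A z u = z u" if "u \<in> B" for u
      using that \<sigma>A(1) AB(2) by (intro strategy_op_notin) (auto dest: movesD(1))
    then have "strategy_op \<sigma>B (strategy_op \<sigma>A z) v = strategy_op (filter (\<lambda>S. S \<subseteq> B) \<sigma>B) z v"
      using v \<sigma>B(1) by (intro strategy_op_cong_on) (auto dest: movesD(1))
    also have "filter (\<lambda>S. S \<subseteq> B) \<sigma>B = \<sigma>B"
      using \<sigma>B(1) by (intro filter_True) (auto dest: movesD(1))
    finally show "strategy_op \<sigma>B z v = strategy_op (\<sigma>A @ \<sigma>B) z v" by simp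
  qed simp
  also have "ip A x (strategy_op (\<sigma>A @ \<sigma>B) z) + ip B x (strategy_op (\<sigma>A @ \<sigma>B) z)
      = ip V x (strategy_op (\<sigma>A @ \<sigma>B) z)"
    unfolding AB(1) using AB by (intro ip_disjoint_union[symmetric]) auto
  finally have "ip V x (strategy_op \<rho> z) \<le> ip V x (strategy_op (\<sigma>A @ \<sigma>B) z)" .
  moreover have "set (\<sigma>A @ \<sigma>B) \<subseteq> moves V"
    using \<sigma>A(1) \<sigma>B(1) moves_mono[OF A] moves_mono[OF AB(5)] by auto
  ultimately show ?thesis using that[of "\<sigma>A @ \<sigma>B"] \<sigma>A(2) \<sigma>B(2) by simp
qed

text \<open>
  A strategy is cut into \<open>m\<close> phases, each the shortest initial segment of what remains that
  crosses every cut, and a last part that leaves some cut uncrossed. Each phase contracts the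
  energy. Without its last move a phase leaves a cut uncrossed as well, so it can be replaced by
  at most \<open>L\<close> moves and that last move.
\<close>

lemma phase_decomposition:
  assumes fin: "finite V" and n: "2 \<le> card V"
    and short_part: "\<And>\<rho> x z. set \<rho> \<subseteq> moves V \<Longrightarrow> \<not> crosses_every_cut V \<rho> \<Longrightarrow>
      \<exists>\<rho>'. set \<rho>' \<subseteq> moves V \<and> length \<rho>' \<le> L \<and> ip V x (strategy_op \<rho> z) \<le> ip V x (strategy_op \<rho>' z)"
    and \<sigma>: "set \<sigma> \<subseteq> moves V"
  shows "\<exists>m. (\<forall>x z. \<exists>\<sigma>'. set \<sigma>' \<subseteq> moves V \<and> length \<sigma>' \<le> (m + 1) * L + m \<and>
             ip V x (strategy_op \<sigma> z) \<le> ip V x (strategy_op \<sigma>' z)) \<and>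
           (\<forall>z. (\<Sum>v\<in>V. z v) = 0 \<longrightarrow> ip V (strategy_op \<sigma> z) (strategy_op \<sigma> z)
             \<le> (1 - 2 / (real (card V))\<^sup>2) ^ m * ip V z z)"
  using \<sigma>
proof (induction "length \<sigma>" arbitrary: \<sigma> rule: less_induct)
  case (less \<sigma>)
  have subV: "S \<subseteq> V" if "set \<tau> \<subseteq> moves V" "S \<in> set \<tau>" for S \<tau>
    using that movesD(1) by blast
  define c where "c = 1 - 2 / (real (card V))\<^sup>2"
  have V: "V \<noteq> {}" using n by auto
  have "2 * 2 \<le> real (card V) * real (card V)" using n by (intro mult_mono) auto
  then have c: "0 \<le> c" using n by (simp add: c_def field_simps power2_eq_square)
  show ?case
  proof (cases "crosses_every_cut V \<sigma>")
    case False
    then show ?thesis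
      using short_part[OF less.prems False] strategy_op_energy_le[OF fin subV[OF less.prems]]
      by (intro exI[of _ 0]) simp
  next
    case True
    then have ex: "\<exists>k. crosses_every_cut V (take k \<sigma>)" by (intro exI[of _ "length \<sigma>"]) simp
    define k where "k = (LEAST k. crosses_every_cut V (take k \<sigma>))"
    have k: "crosses_every_cut V (take k \<sigma>)" unfolding k_def using ex by (rule LeastI_ex)
    have "\<not> crosses_every_cut V []"
    proof -
      obtain a where "a \<in> V" using V by auto
      moreover have "V \<noteq> {a}" using n by auto
      ultimately show ?thesis unfolding crosses_every_cut_def by (auto intro!: exI[of _ "{a}"])
    qed
    then have "k \<noteq> 0" using k by (intro notI) simp
    then obtain j where j: "k = Suc j" by (cases k) auto
    then have ns: "\<not> crosses_every_cut V (take j \<sigma>)" using not_less_Least[of j "\<lambda>k. crosses_every_cut V (take k \<sigma>)"] by (simp add: k_def)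
    have "j < length \<sigma>"
    proof (rule ccontr)
      assume "\<not> j < length \<sigma>"
      then show False using ns True by simp
    qed
    define \<rho> S \<sigma>2 where "\<rho> = take j \<sigma>" and "S = \<sigma> ! j" and "\<sigma>2 = drop k \<sigma>"
    have \<sigma>_eq: "\<sigma> = \<rho> @ S # \<sigma>2" and tk: "take k \<sigma> = \<rho> @ [S]"
      using \<open>j < length \<sigma>\<close> by (simp_all add: \<rho>_def S_def \<sigma>2_def j id_take_nth_drop[symmetric] take_Suc_conv_app_nth)
    have mv: "set \<rho> \<subseteq> moves V" "S \<in> moves V" "set \<sigma>2 \<subseteq> moves V"
      using less.prems by (auto simp: \<sigma>_eq)
    have "length \<sigma>2 < length \<sigma>" by (simp add: \<sigma>_eq)
    from less.hyps[OF this mv(3)] obtain m where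
      m1: "\<forall>x z. \<exists>\<sigma>'. set \<sigma>' \<subseteq> moves V \<and> length \<sigma>' \<le> (m + 1) * L + m \<and>
             ip V x (strategy_op \<sigma>2 z) \<le> ip V x (strategy_op \<sigma>' z)" and
      m2: "\<forall>z. (\<Sum>v\<in>V. z v) = 0 \<longrightarrow> ip V (strategy_op \<sigma>2 z) (strategy_op \<sigma>2 z) \<le> c ^ m * ip V z z"
      unfolding c_def by blast
    have "\<exists>\<sigma>'. set \<sigma>' \<subseteq> moves V \<and> length \<sigma>' \<le> (Suc m + 1) * L + Suc m \<and>
             ip V x (strategy_op \<sigma> z) \<le> ip V x (strategy_op \<sigma>' z)" for x z
    proof -
      define x' where "x' = strategy_op (rev (S # \<sigma>2)) x"
      have "T \<subseteq> V" if "T \<in> set (S # \<sigma>2)" for T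
      proof (rule movesD(1))
        show "T \<in> moves V" using that mv by auto
      qed
      note seg = ip_strategy_segment[of V "S # \<sigma>2" x "[]", OF fin this, folded x'_def]
      obtain \<rho>' where \<rho>': "set \<rho>' \<subseteq> moves V" "length \<rho>' \<le> L"
        "ip V x' (strategy_op \<rho> z) \<le> ip V x' (strategy_op \<rho>' z)"
        using short_part[OF mv(1), of x' z] ns by (auto simp: \<rho>_def)
      define z' where "z' = strategy_op (\<rho>' @ [S]) z"
      obtain \<tau> where \<tau>: "set \<tau> \<subseteq> moves V" "length \<tau> \<le> (m + 1) * L + m"
        "ip V x (strategy_op \<sigma>2 z') \<le> ip V x (strategy_op \<tau> z')"
        using m1 by blast
      have "ip V x (strategy_op \<sigma> z) = ip V x' (strategy_op \<rho> z)"
        using seg[of \<rho> z] by (simp add: \<sigma>_eq)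
      also note \<rho>'(3)
      also have "ip V x' (strategy_op \<rho>' z) = ip V x (strategy_op \<sigma>2 z')"
        using seg[of \<rho>' z] by (simp add: z'_def)
      also note \<tau>(3)
      finally have "ip V x (strategy_op \<sigma> z) \<le> ip V x (strategy_op (\<rho>' @ S # \<tau>) z)"
        by (simp add: z'_def)
      moreover have "set (\<rho>' @ S # \<tau>) \<subseteq> moves V" using \<rho>'(1) mv(2) \<tau>(1) by simp
      moreover have "length (\<rho>' @ S # \<tau>) \<le> (Suc m + 1) * L + Suc m"
        using \<rho>'(2) \<tau>(2) by simp
      ultimately show ?thesis by blast
    qed
    moreover have "ip V (strategy_op \<sigma> z) (strategy_op \<sigma> z) \<le> c ^ Suc m * ip V z z"
      if "(\<Sum>v\<in>V. z v) = 0" for z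
    proof -
      define y where "y = strategy_op (\<rho> @ [S]) z"
      have mv': "set (\<rho> @ [S]) \<subseteq> moves V" using mv by simp
      have "(\<Sum>v\<in>V. y v) = 0"
        unfolding y_def using sum_strategy_op[OF fin subV[OF mv'], of "\<rho> @ [S]" z] that by simp
      then have "ip V (strategy_op \<sigma>2 y) (strategy_op \<sigma>2 y) \<le> c ^ m * ip V y y" using m2 by blast
      also have "c ^ m * ip V y y \<le> c ^ m * (c * ip V z z)"
      proof (rule mult_left_mono)
        show "ip V y y \<le> c * ip V z z"
          unfolding y_def c_def
        proof (rule crosses_every_cut_contracts[OF fin _ V])
          show "\<forall>T\<in>set (\<rho> @ [S]). T \<subseteq> V \<and> T \<noteq> {}" using mv' movesD by blast
          show "crosses_every_cut V (\<rho> @ [S])" using k tk by simp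
        qed (fact that)
      qed (use c in simp)
      finally show ?thesis
        by (simp add: \<sigma>_eq y_def algebra_simps)
    qed
    ultimately show ?thesis unfolding c_def by (intro exI[of _ "Suc m"]) blast
  qed
qed

text \<open>
  If \<open>S\<close> and \<open>insert w S\<close> are connected and contain \<open>a\<close>, the sums of \<open>z\<close> over these two sets
  differ by \<open>z w\<close>, so one of them is large, and averaging over that set makes the value at \<open>a\<close>
  large.
\<close>

lemma large_value_at_vertex:
  assumes fin: "finite V" and V: "conn V" and a: "a \<in> V" and w: "w \<in> V"
  obtains S where "S \<in> moves V" "\<bar>z w\<bar> \<le> 2 * real (card V) * \<bar>avg_op S z a\<bar>"
proof -
  have large: "\<bar>r\<bar> \<le> real (card V) * \<bar>avg_op S z a\<bar>"
    if "S \<subseteq> V" "a \<in> S" "r = (\<Sum>v\<in>S. z v)" for S r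
  proof -
    have "finite S" using that fin by (auto intro: finite_subset)
    then have S: "0 < card S" "card S \<le> card V"
      using that fin by (auto simp: card_gt_0_iff intro: card_mono)
    then have "r = real (card S) * avg_op S z a" using that by (simp add: avg_op_def)
    then have "\<bar>r\<bar> = real (card S) * \<bar>avg_op S z a\<bar>" by (simp add: abs_mult)
    also have "\<dots> \<le> real (card V) * \<bar>avg_op S z a\<bar>" using S by (intro mult_right_mono) auto
    finally show ?thesis .
  qed
  show ?thesis
  proof (cases "a = w")
    case True
    have "\<bar>z w\<bar> \<le> real (card V) * \<bar>avg_op {a} z a\<bar>" using a True by (intro large) auto
    then have "\<bar>z w\<bar> \<le> 2 * real (card V) * \<bar>avg_op {a} z a\<bar>" by simp
    moreover have "{a} \<in> moves V" using a conn_singleton by (auto simp: moves_def)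
    ultimately show ?thesis using that by blast
  next
    case False
    obtain S where S: "conn S" "a \<in> S" "S \<subseteq> V - {w}" "conn (insert w S)"
      using conn_maximal_avoiding[OF fin V a w False] by blast
    have mv: "S \<in> moves V" "insert w S \<in> moves V" using S w by (auto simp: moves_def)
    have "finite S" "w \<notin> S" using S fin by (auto intro: finite_subset)
    then have "z w = (\<Sum>v\<in>insert w S. z v) - (\<Sum>v\<in>S. z v)" by simp
    moreover have "\<bar>\<Sum>v\<in>insert w S. z v\<bar> \<le> real (card V) * \<bar>avg_op (insert w S) z a\<bar>"
      using S w by (intro large) auto
    moreover have "\<bar>\<Sum>v\<in>S. z v\<bar> \<le> real (card V) * \<bar>avg_op S z a\<bar>"
      using S by (intro large) auto
    ultimately have "\<bar>z w\<bar> \<le> 2 * real (card V) * \<bar>avg_op (insert w S) z a\<bar> \<or>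
        \<bar>z w\<bar> \<le> 2 * real (card V) * \<bar>avg_op S z a\<bar>" by linarith
    then show ?thesis using mv that by blast
  qed
qed

text \<open>
  For mean zero, averaging over \<open>V - {a}\<close> gives a vector that is proportional to the deviation
  of the indicator of \<open>a\<close> from its mean; its entries away from \<open>a\<close> have the sign opposite to
  that at \<open>a\<close>. So if \<open>x a\<close> and \<open>z a\<close> have opposite signs, three further such moves, passing
  through \<open>b\<close> and \<open>c\<close> and back to \<open>a\<close>, flip the sign an odd number of times. This is where three
  deletable vertices are needed.
\<close>

lemma align_signs:
  assumes fin: "finite V" and abc: "distinct [a, b, c]" "noncut V a" "noncut V b" "noncut V c"
    and x: "(\<Sum>v\<in>V. x v) = 0" and z: "(\<Sum>v\<in>V. z v) = 0"
  obtains \<tau> where "set \<tau> \<subseteq> moves V" "length \<tau> \<le> 4"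
    "\<bar>x a\<bar> * \<bar>z a\<bar> \<le> real (card V) ^ 3 * ip V x (strategy_op \<tau> z)"
proof -
  define n where "n = real (card V)"
  have inV: "a \<in> V" "b \<in> V" "c \<in> V" using abc by (auto simp: noncut_def)
  have "card {a, b, c} \<le> card V" using inV fin by (intro card_mono) auto
  then have n: "3 \<le> n" using abc(1) by (simp add: n_def)
  have mv: "V - {a} \<in> moves V" "V - {b} \<in> moves V" "V - {c} \<in> moves V"
    using abc by (auto simp: moves_def noncut_def)
  have del: "avg_op (V - {p}) y v = (if v = p then y p else - y p / (n - 1))"
    if "p \<in> V" "(\<Sum>v\<in>V. y v) = 0" "v \<in> V" for p y v
    unfolding n_def using avg_op_delete_vertex[OF fin that] .
  have zero: "(\<Sum>v\<in>V. avg_op (V - {p}) y v) = 0" if "(\<Sum>v\<in>V. y v) = 0" for p y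
    using sum_strategy_op[OF fin, of "[V - {p}]" y] that by simp
  have val: "ip V x (avg_op (V - {a}) y) = n / (n - 1) * (x a * y a)" if y: "(\<Sum>v\<in>V. y v) = 0" for y
  proof -
    have "ip V x (avg_op (V - {a}) y) = (\<Sum>v\<in>V. x v * (if v = a then y a else - y a / (n - 1)))"
      using del[OF inV(1) y] by (simp add: ip_def)
    also have "\<dots> = x a * y a + (\<Sum>v\<in>V - {a}. x v * (- y a / (n - 1)))"
      by (subst sum.remove[OF fin inV(1)]) (auto intro!: sum.cong)
    also have "(\<Sum>v\<in>V - {a}. x v * (- y a / (n - 1))) = (\<Sum>v\<in>V - {a}. x v) * (- y a / (n - 1))"
      by (rule sum_distrib_right[symmetric])
    also have "(\<Sum>v\<in>V - {a}. x v) = - x a" using x sum.remove[OF fin inV(1), of x] by simp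
    finally show ?thesis using n by (simp add: field_simps)
  qed
  have n1: "1 \<le> n / (n - 1)" using n by (simp add: field_simps)
  show ?thesis
  proof (cases "0 \<le> x a * z a")
    case True
    have "\<bar>x a\<bar> * \<bar>z a\<bar> = 1 * (x a * z a)" using True by (simp add: abs_mult[symmetric])
    also have "\<dots> \<le> n / (n - 1) * (x a * z a)" using True n1 by (rule mult_right_mono[rotated])
    also have "\<dots> = 1 * ip V x (avg_op (V - {a}) z)" using val[OF z] by simp
    also have "\<dots> \<le> n ^ 3 * ip V x (avg_op (V - {a}) z)"
      using val[OF z] True n by (intro mult_right_mono) (auto simp: one_le_power)
    finally show ?thesis using that[of "[V - {a}]"] mv by (simp add: n_def)
  next
    case False
    define y1 y2 y3 where "y1 = avg_op (V - {a}) z" and "y2 = avg_op (V - {b}) y1"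
      and "y3 = avg_op (V - {c}) y2"
    have z1: "(\<Sum>v\<in>V. y1 v) = 0" unfolding y1_def using z by (rule zero)
    have z2: "(\<Sum>v\<in>V. y2 v) = 0" unfolding y2_def using z1 by (rule zero)
    have z3: "(\<Sum>v\<in>V. y3 v) = 0" unfolding y3_def using z2 by (rule zero)
    have "y1 b = - z a / (n - 1)" unfolding y1_def using del[OF inV(1) z inV(2)] abc(1) by auto
    moreover have "y2 c = - y1 b / (n - 1)" unfolding y2_def using del[OF inV(2) z1 inV(3)] abc(1) by auto
    moreover have "y3 a = - y2 c / (n - 1)" unfolding y3_def using del[OF inV(3) z2 inV(1)] abc(1) by auto
    ultimately have y3: "y3 a = - z a / (n - 1) ^ 3" by (simp add: power3_eq_cube)
    have v: "ip V x (avg_op (V - {a}) y3) = n / (n - 1) * (\<bar>x a\<bar> * \<bar>z a\<bar> / (n - 1) ^ 3)"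
      using val[OF z3] False by (simp add: y3 abs_mult[symmetric])
    have "1 \<le> n ^ 3 / (n - 1) ^ 3" using n by (simp add: power_mono)
    then have "1 * 1 \<le> n / (n - 1) * (n ^ 3 / (n - 1) ^ 3)" using n1 by (intro mult_mono) auto
    then have "\<bar>x a\<bar> * \<bar>z a\<bar> * 1 \<le> \<bar>x a\<bar> * \<bar>z a\<bar> * (n / (n - 1) * (n ^ 3 / (n - 1) ^ 3))"
      by (intro mult_left_mono) auto
    also have "\<dots> = n ^ 3 * ip V x (avg_op (V - {a}) y3)" unfolding v by simp
    finally show ?thesis
      using that[of "[V - {a}, V - {b}, V - {c}, V - {a}]"] mv
      by (simp add: n_def y1_def y2_def y3_def)
  qed
qed

text \<open>
  Six moves reach a value comparable, up to a power of \<open>card V\<close>, with the largest entries of \<open>x\<close>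
  and \<open>z\<close>.
\<close>

lemma large_short_value:
  assumes fin: "finite V" and V: "conn V"
    and abc: "distinct [a, b, c]" "noncut V a" "noncut V b" "noncut V c"
    and x: "(\<Sum>v\<in>V. x v) = 0" and z: "(\<Sum>v\<in>V. z v) = 0"
    and uw: "u \<in> V" "w \<in> V"
  obtains \<tau> where "set \<tau> \<subseteq> moves V" "length \<tau> \<le> 6"
    "\<bar>x u\<bar> * \<bar>z w\<bar> \<le> 4 * real (card V) ^ 5 * ip V x (strategy_op \<tau> z)"
proof -
  define n where "n = real (card V)"
  have a: "a \<in> V" using abc by (auto simp: noncut_def)
  obtain S where S: "S \<in> moves V" "\<bar>x u\<bar> \<le> 2 * n * \<bar>avg_op S x a\<bar>"
    unfolding n_def using large_value_at_vertex[OF fin V a uw(1)] by blast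
  obtain T where T: "T \<in> moves V" "\<bar>z w\<bar> \<le> 2 * n * \<bar>avg_op T z a\<bar>"
    unfolding n_def using large_value_at_vertex[OF fin V a uw(2)] by blast
  have SV: "S \<subseteq> V" "T \<subseteq> V" using S T movesD(1) by auto
  have "(\<Sum>v\<in>V. avg_op S x v) = 0" "(\<Sum>v\<in>V. avg_op T z v) = 0"
    using sum_strategy_op[OF fin, of "[S]" x] sum_strategy_op[OF fin, of "[T]" z] x z SV by simp_all
  then obtain \<tau> where \<tau>: "set \<tau> \<subseteq> moves V" "length \<tau> \<le> 4"
    "\<bar>avg_op S x a\<bar> * \<bar>avg_op T z a\<bar> \<le> n ^ 3 * ip V (avg_op S x) (strategy_op \<tau> (avg_op T z))"
    unfolding n_def by (rule align_signs[OF fin abc])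
  have "\<bar>x u\<bar> * \<bar>z w\<bar> \<le> (2 * n * \<bar>avg_op S x a\<bar>) * (2 * n * \<bar>avg_op T z a\<bar>)"
    using S(2) T(2) by (intro mult_mono) (auto simp: n_def)
  also have "\<dots> = (4 * n\<^sup>2) * (\<bar>avg_op S x a\<bar> * \<bar>avg_op T z a\<bar>)"
    by (simp add: power2_eq_square)
  also have "\<dots> \<le> (4 * n\<^sup>2) * (n ^ 3 * ip V (avg_op S x) (strategy_op \<tau> (avg_op T z)))"
    using \<tau>(3) by (intro mult_left_mono) auto
  also have "\<dots> = 4 * n ^ 5 * ip V x (strategy_op (T # \<tau> @ [S]) z)"
    using avg_op_self_adjoint[OF fin SV(1)] by (simp add: power_add[symmetric] flip: mult.assoc)
  finally show ?thesis
    using that[of "T # \<tau> @ [S]"] S(1) T(1) \<tau>(1,2) by (simp add: n_def)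
qed

end

text \<open>
  With \<open>l = \<lceil>log 2 n\<rceil>\<close>, the lower bound on \<open>m\<close> is twice the value of \<^const>\<open>q_seq\<close> at \<open>n\<close>.
\<close>

lemma contraction_power_bound:
  fixes n :: real
  assumes n: "2 \<le> n" "n \<le> 2 ^ l" and m: "8 * n\<^sup>2 * real l \<le> real m"
  shows "(1 - 2 / n\<^sup>2) ^ m \<le> (1 / n) ^ 16"
proof -
  have "2 * 2 \<le> n * n" using n by (intro mult_mono) auto
  then have "0 \<le> 1 - 2 / n\<^sup>2" using n by (simp add: field_simps power2_eq_square)
  moreover have "1 - 2 / n\<^sup>2 \<le> exp (- (2 / n\<^sup>2))" using exp_ge_add_one_self[of "- (2 / n\<^sup>2)"] by simp
  ultimately have "(1 - 2 / n\<^sup>2) ^ m \<le> exp (- (2 / n\<^sup>2)) ^ m" by (rule power_mono[rotated])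
  also have "\<dots> = exp (- (2 * real m / n\<^sup>2))" by (simp add: exp_of_nat_mult[symmetric])
  also have "\<dots> \<le> exp (real (16 * l) * (- 1))"
  proof -
    have "16 * real l \<le> 2 * real m / n\<^sup>2" using m n by (simp add: field_simps)
    then show ?thesis by simp
  qed
  also have "\<dots> = exp (- 1) ^ (16 * l)" by (simp only: exp_of_nat_mult)
  also have "\<dots> \<le> (1 / 2) ^ (16 * l)"
  proof (rule power_mono)
    have "2 \<le> exp (1::real)" using exp_ge_add_one_self[of 1] by simp
    then show "exp (- 1) \<le> (1 / 2 :: real)" by (simp add: exp_minus field_simps)
  qed simp
  also have "\<dots> = ((1 / 2 ^ l) ^ 16 :: real)" by (simp add: power_mult[symmetric] power_divide mult.commute)
  also have "\<dots> \<le> (1 / n) ^ 16" using n by (intro power_mono divide_left_mono) auto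
  finally show ?thesis .
qed

section \<open>The recursive bound\<close>

context symmetric_relation
begin

lemma shorten_leaving_cut_uncrossed:
  assumes fin: "finite V"
    and smaller: "\<forall>A. A \<noteq> {} \<and> A \<subset> V \<longrightarrow> short_strategies A (L_seq (card A))"
    and \<rho>: "set \<rho> \<subseteq> moves V" "\<not> crosses_every_cut V \<rho>"
  obtains \<rho>' where "set \<rho>' \<subseteq> moves V" "length \<rho>' \<le> L_seq (card V - 1)"
    "ip V x (strategy_op \<rho> z) \<le> ip V x (strategy_op \<rho>' z)"
proof -
  have "\<exists>A. A \<noteq> {} \<and> A \<subset> V \<and> (\<forall>S\<in>set \<rho>. S \<inter> A = {} \<or> S - A = {})"
    using \<rho>(2) unfolding crosses_every_cut_def by metis
  then obtain A where A: "A \<noteq> {}" "A \<subset> V" "\<forall>S\<in>set \<rho>. S \<inter> A = {} \<or> S - A = {}"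
    by blast
  have IH: "short_strategies B (L_seq (card B))" if "B \<noteq> {}" "B \<subset> V" for B
    using smaller that by simp
  have AV: "A \<subseteq> V" "V - A \<noteq> {}" "V - A \<subset> V" using A(1,2) by auto
  have finA: "finite A" using AV(1) fin by (rule finite_subset)
  have c: "card A + card (V - A) = card V"
    using card_Diff_subset[OF finA AV(1)] card_mono[OF fin AV(1)] by simp
  have c1: "1 \<le> card A" "1 \<le> card (V - A)"
    using A(1) AV(2) fin finA by (simp_all add: Suc_le_eq card_gt_0_iff)
  have side: "S \<subseteq> A \<or> S \<inter> A = {}" if "S \<in> set \<rho>" for S
    using bspec[OF A(3) that] by auto
  obtain \<rho>' where \<rho>': "set \<rho>' \<subseteq> moves V" "length \<rho>' \<le> L_seq (card A) + L_seq (card (V - A))"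
    "ip V x (strategy_op \<rho> z) \<le> ip V x (strategy_op \<rho>' z)"
    using split_strategy[OF fin AV(1) \<rho>(1) side IH[OF A(1,2)] IH[OF AV(2,3)]] .
  have "length \<rho>' \<le> L_seq (card V - 1)"
    using \<rho>'(2) L_seq_superadditive[OF c1] by (simp add: c)
  with \<rho>'(1) show ?thesis using \<rho>'(3) by (rule that)
qed

text \<open>
  A disconnected \<open>V\<close> has a cut that no move crosses, and a connected \<open>V\<close> without three deletable
  vertices is a path. In the remaining case a strategy of few phases is shortened phase by
  phase, while one of many phases has lost so much energy that the six moves of
  \<open>large_short_value\<close> do at least as well.
\<close>

lemma short_strategies_L_seq:
  assumes "finite V" "V \<noteq> {}"
  shows "short_strategies V (L_seq (card V))"
  using assms
proof (induction "card V" arbitrary: V rule: less_induct)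
  case (less V)
  note fin = less.prems(1)
  define n where "n = card V"
  have n1: "1 \<le> n" using less.prems by (simp add: n_def Suc_le_eq card_gt_0_iff)
  have IH: "\<forall>A. A \<noteq> {} \<and> A \<subset> V \<longrightarrow> short_strategies A (L_seq (card A))"
  proof (intro allI impI, elim conjE)
    fix A assume A: "A \<noteq> {}" "A \<subset> V"
    then have "finite A" using fin by (auto intro: finite_subset)
    with psubset_card_mono[OF fin A(2)] show "short_strategies A (L_seq (card A))"
      using A(1) by (rule less.hyps)
  qed
  consider "\<not> conn V"
    | "conn V" "\<not> (\<exists>a b c. distinct [a, b, c] \<and> noncut V a \<and> noncut V b \<and> noncut V c)"
    | a b c where "conn V" "distinct [a, b, c]" "noncut V a" "noncut V b" "noncut V c"
    by blast
  then show ?case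
  proof cases
    case 1
    then obtain A where A: "A \<noteq> {}" "A \<subset> V" "\<And>u v. u \<in> A \<Longrightarrow> v \<in> V - A \<Longrightarrow> \<not> E u v"
      using less.prems(2) unfolding conn_def by blast
    have side: "S \<inter> A = {} \<or> S - A = {}" if S: "S \<in> moves V" for S
    proof (rule ccontr)
      assume "\<not> (S \<inter> A = {} \<or> S - A = {})"
      then have "S \<inter> A \<noteq> {}" "S \<inter> A \<subset> S" by auto
      moreover have "conn S" "S \<subseteq> V" using S by (auto simp: moves_def)
      ultimately obtain u v where "u \<in> S \<inter> A" "v \<in> S - S \<inter> A" "E u v" using conn_crossing by metis
      then show False using A(3)[of u v] \<open>S \<subseteq> V\<close> by auto
    qed
    show ?thesis
      unfolding short_strategies_def
    proof (intro allI impI)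
      fix x z \<sigma> assume \<sigma>: "set \<sigma> \<subseteq> moves V"
      have "\<not> crosses_every_cut V \<sigma>" using A(1,2) side \<sigma> unfolding crosses_every_cut_def by blast
      with \<sigma> obtain \<rho>' where "set \<rho>' \<subseteq> moves V" "length \<rho>' \<le> L_seq (card V - 1)"
        "ip V x (strategy_op \<sigma> z) \<le> ip V x (strategy_op \<rho>' z)"
        by (rule shorten_leaving_cut_uncrossed[OF fin IH])
      moreover have "L_seq (card V - 1) \<le> L_seq (card V)"
      proof (cases "n = 1")
        case False
        then show ?thesis using n1 by (intro L_seq_mono) (auto simp: n_def)
      qed (simp add: n_def)
      ultimately show "\<exists>\<sigma>'. set \<sigma>' \<subseteq> moves V \<and> length \<sigma>' \<le> L_seq (card V) \<and>
          ip V x (strategy_op \<sigma> z) \<le> ip V x (strategy_op \<sigma>' z)" by (meson order_trans)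
    qed
  next
    case 2
    show ?thesis
      using path_short_strategies[OF fin 2] exponential_le_L_seq[OF n1]
      unfolding short_strategies_def n_def by (meson order_trans)
  next
    case 3
    note abc = 3(2-5)
    have "{a, b, c} \<subseteq> V" using abc by (auto simp: noncut_def)
    then have "card {a, b, c} \<le> n" unfolding n_def using fin by (rule card_mono[rotated])
    then have n: "3 \<le> n" using abc(1) by simp
    define L where "L = L_seq (n - 1)"
    define q where "q = q_seq n"
    have rec: "L_seq n = 2 * q * (L + 1)" using L_seq_rec[OF n] by (simp add: L_def q_def)
    define l where "l = nat \<lceil>log 2 (real n)\<rceil>"
    have "log 2 (real n) \<le> real l" unfolding l_def by linarith
    then have l: "real n \<le> 2 ^ l" using n by (simp add: log_le_iff powr_realpow)
    have q: "q = 4 * n\<^sup>2 * l" by (simp add: q_def q_seq_def l_def)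
    have "6 \<le> L_seq n"
    proof -
      have "1 \<le> l"
      proof (rule ccontr)
        assume "\<not> 1 \<le> l"
        then have "l = 0" by simp
        then show False using l n by simp
      qed
      then have "4 * (1 * 1) * 1 \<le> q" unfolding q power2_eq_square using n by (intro mult_le_mono) auto
      then show ?thesis unfolding rec by (simp add: algebra_simps)
    qed
    show ?thesis
      unfolding short_strategies_def
    proof (intro allI impI)
      fix x z \<sigma> assume \<sigma>: "set \<sigma> \<subseteq> moves V"
      have short_part: "\<exists>\<rho>'. set \<rho>' \<subseteq> moves V \<and> length \<rho>' \<le> L \<and>
          ip V x (strategy_op \<rho> z) \<le> ip V x (strategy_op \<rho>' z)"
        if "set \<rho> \<subseteq> moves V" "\<not> crosses_every_cut V \<rho>" for \<rho> x z
        using shorten_leaving_cut_uncrossed[OF fin IH that, of x z] unfolding L_def n_def by metis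
      have "2 \<le> card V" using n by (simp add: n_def)
      from phase_decomposition[OF fin this short_part \<sigma>] obtain m where
        m1: "\<exists>\<sigma>'. set \<sigma>' \<subseteq> moves V \<and> length \<sigma>' \<le> (m + 1) * L + m \<and>
             ip V x (strategy_op \<sigma> z) \<le> ip V x (strategy_op \<sigma>' z)" and
        m2: "\<And>z. (\<Sum>v\<in>V. z v) = 0 \<Longrightarrow> ip V (strategy_op \<sigma> z) (strategy_op \<sigma> z)
             \<le> (1 - 2 / (real n)\<^sup>2) ^ m * ip V z z"
        unfolding n_def by blast
      show "\<exists>\<sigma>'. set \<sigma>' \<subseteq> moves V \<and> length \<sigma>' \<le> L_seq (card V) \<and>
          ip V x (strategy_op \<sigma> z) \<le> ip V x (strategy_op \<sigma>' z)"
      proof (cases "m + 1 \<le> 2 * q")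
        case True
        have "(m + 1) * L + m \<le> 2 * q * L + 2 * q" using True by (intro add_mono mult_le_mono) auto
        also have "\<dots> = L_seq (card V)" using rec by (simp add: n_def algebra_simps)
        finally show ?thesis using m1 by (meson order_trans)
      next
        case False
        have subV: "S \<subseteq> V" if "set \<tau> \<subseteq> moves V" "S \<in> set \<tau>" for S \<tau>
          using that movesD(1) by blast
        have ok: "finite S \<and> S \<noteq> {}" if "set \<tau> \<subseteq> moves V" "S \<in> set \<tau>" for S \<tau>
          using that movesD fin finite_subset by (metis subsetD)
        \<comment> \<open>Constants contribute the same amount to the value of every strategy.\<close>
        define mx mz where "mx = (\<Sum>v\<in>V. x v) / real n" and "mz = (\<Sum>v\<in>V. z v) / real n"
        define x0 z0 where "x0 v = x v - mx" and "z0 v = z v - mz" for v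
        have sum0: "(\<Sum>v\<in>V. x0 v) = 0" "(\<Sum>v\<in>V. z0 v) = 0"
          using n by (simp_all add: x0_def z0_def mx_def mz_def sum_subtractf n_def[symmetric])
        have centred: "ip V x (strategy_op \<tau> z) = ip V x0 (strategy_op \<tau> z0) + real n * mx * mz"
          if \<tau>: "set \<tau> \<subseteq> moves V" for \<tau>
        proof -
          have "strategy_op \<tau> z = strategy_op \<tau> (\<lambda>v. z0 v + mz)" by (simp add: z0_def)
          also have "\<dots> = (\<lambda>v. strategy_op \<tau> z0 v + mz)" by (rule strategy_op_add_const[OF ok[OF \<tau>]])
          finally have "ip V x (strategy_op \<tau> z) = (\<Sum>v\<in>V. (x0 v + mx) * (strategy_op \<tau> z0 v + mz))"
            by (simp add: ip_def x0_def)
          also have "\<dots> = ip V x0 (strategy_op \<tau> z0) + mz * (\<Sum>v\<in>V. x0 v)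
              + mx * (\<Sum>v\<in>V. strategy_op \<tau> z0 v) + real n * mx * mz"
            by (simp add: ip_def n_def algebra_simps sum.distrib sum_distrib_left)
          also have "(\<Sum>v\<in>V. strategy_op \<tau> z0 v) = 0"
            using sum_strategy_op[OF fin subV[OF \<tau>], of \<tau> z0] sum0 by simp
          finally show ?thesis using sum0 by simp
        qed
        have max: "\<exists>u\<in>V. \<forall>v\<in>V. \<bar>y v\<bar> \<le> \<bar>y u\<bar>" for y :: "'v \<Rightarrow> real"
        proof -
          have "Max ((\<lambda>v. \<bar>y v\<bar>) ` V) \<in> (\<lambda>v. \<bar>y v\<bar>) ` V" using fin less.prems(2) by (intro Max_in) auto
          then obtain u where u: "u \<in> V" "Max ((\<lambda>v. \<bar>y v\<bar>) ` V) = \<bar>y u\<bar>" by auto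
          have "\<bar>y v\<bar> \<le> \<bar>y u\<bar>" if "v \<in> V" for v using that fin by (simp flip: u(2))
          then show ?thesis using u(1) by blast
        qed
        have energy: "ip V y y \<le> real n * \<bar>y u\<bar>\<^sup>2" if "\<forall>v\<in>V. \<bar>y v\<bar> \<le> \<bar>y u\<bar>" for y :: "'v \<Rightarrow> real" and u
          unfolding ip_def n_def
        proof (rule sum_bounded_above)
          fix v assume "v \<in> V"
          then have "\<bar>y v\<bar>\<^sup>2 \<le> \<bar>y u\<bar>\<^sup>2" using that by (intro power_mono) auto
          then show "y v * y v \<le> \<bar>y u\<bar>\<^sup>2" by (simp add: power2_eq_square)
        qed
        obtain u where u: "u \<in> V" "\<forall>v\<in>V. \<bar>x0 v\<bar> \<le> \<bar>x0 u\<bar>" using max[of x0] by blast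
        obtain w where w: "w \<in> V" "\<forall>v\<in>V. \<bar>z0 v\<bar> \<le> \<bar>z0 w\<bar>" using max[of z0] by blast
        define M where "M = \<bar>x0 u\<bar> * \<bar>z0 w\<bar>"
        obtain \<tau> where \<tau>: "set \<tau> \<subseteq> moves V" "length \<tau> \<le> 6"
          "M \<le> 4 * real n ^ 5 * ip V x0 (strategy_op \<tau> z0)"
          unfolding M_def n_def by (rule large_short_value[OF fin 3(1) abc sum0 u(1) w(1)])
        define s t where "s = ip V x0 (strategy_op \<sigma> z0)" and "t = ip V x0 (strategy_op \<tau> z0)"
        have "2 * q \<le> m" using False by simp
        then have "real (8 * n\<^sup>2 * l) \<le> real m" unfolding q of_nat_le_iff by simp
        then have power: "(1 - 2 / (real n)\<^sup>2) ^ m \<le> (1 / real n) ^ 16"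
          using n l by (intro contraction_power_bound[of _ l]) auto
        have "s\<^sup>2 \<le> ip V x0 x0 * ip V (strategy_op \<sigma> z0) (strategy_op \<sigma> z0)"
          unfolding s_def by (rule ip_Cauchy_Schwarz)
        also have "\<dots> \<le> (real n * \<bar>x0 u\<bar>\<^sup>2) * ((1 / real n) ^ 16 * (real n * \<bar>z0 w\<bar>\<^sup>2))"
        proof (rule mult_mono)
          have "ip V (strategy_op \<sigma> z0) (strategy_op \<sigma> z0) \<le> (1 - 2 / (real n)\<^sup>2) ^ m * ip V z0 z0"
            using sum0(2) by (rule m2)
          also have "\<dots> \<le> (1 / real n) ^ 16 * (real n * \<bar>z0 w\<bar>\<^sup>2)"
            using power energy[OF w(2)] ip_self_nonneg by (intro mult_mono) auto
          finally show "ip V (strategy_op \<sigma> z0) (strategy_op \<sigma> z0) \<le> (1 / real n) ^ 16 * (real n * \<bar>z0 w\<bar>\<^sup>2)" .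
        qed (use energy[OF u(2)] ip_self_nonneg in auto)
        also have "\<dots> = (real n * (1 / real n) ^ 16 * real n) * M\<^sup>2"
          by (simp add: M_def power_mult_distrib)
        also have "real n * (1 / real n) ^ 16 * real n = (1 / real n ^ 7)\<^sup>2"
          using n by (simp add: field_simps eval_nat_numeral)
        also have "(1 / real n ^ 7)\<^sup>2 * M\<^sup>2 = (M / real n ^ 7)\<^sup>2"
          by (simp add: power_divide)
        finally have "s \<le> M / real n ^ 7"
          by (rule power2_le_imp_le) (simp add: M_def)
        also have "M / real n ^ 7 \<le> 4 * real n ^ 5 * t / real n ^ 7"
          using \<tau>(3) by (intro divide_right_mono) (auto simp: t_def)
        also have "\<dots> = 4 / (real n)\<^sup>2 * t"
          using n by (simp add: field_simps flip: power_add)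
        also have "\<dots> \<le> 1 * t"
        proof (rule mult_right_mono)
          have "2 * 2 \<le> real n * real n" using n by (intro mult_mono) auto
          then show "4 / (real n)\<^sup>2 \<le> 1" using n by (simp add: power2_eq_square field_simps)
          have "0 \<le> 4 * real n ^ 5 * t" using \<tau>(3) by (simp add: t_def M_def order_trans[OF _ \<tau>(3)])
          then show "0 \<le> t" using n by (simp add: zero_le_mult_iff)
        qed
        finally have "ip V x (strategy_op \<sigma> z) \<le> ip V x (strategy_op \<tau> z)"
          by (simp add: centred \<sigma> \<tau>(1) s_def t_def)
        moreover have "length \<tau> \<le> L_seq (card V)" using \<tau>(2) \<open>6 \<le> L_seq n\<close> by (simp add: n_def)
        ultimately show ?thesis using \<tau>(1) by blast
      qed
    qed
  qed
qed

end

text \<open>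
  The library notion is reachability inside the induced subgraph; it agrees with the description
  by cuts.
\<close>

lemma connected_set_iff_conn:
  assumes G: "Digraph.graph G"
  shows "connected_set G S \<longleftrightarrow>
    S \<subseteq> verts G \<and> symmetric_relation.conn (\<lambda>u v. (u, v) \<in> arcs_ends G) S"
proof -
  interpret graph G by fact
  interpret symmetric_relation "\<lambda>u v. (u, v) \<in> arcs_ends G"
    using sym_arcs by unfold_locales (simp add: symmetric_def sym_def)
  let ?R = "(arcs_ends (G \<restriction> S))\<^sup>s"
  have R: "(u, v) \<in> ?R \<longleftrightarrow> u \<in> S \<and> v \<in> S \<and> (u, v) \<in> arcs_ends G" for u v
    using sym by (auto simp: symcl_def arcs_ends_conv)
  have "(\<forall>u\<in>S. \<forall>v\<in>S. (u, v) \<in> rtrancl_on S ?R) \<longleftrightarrow> conn S" if "S \<noteq> {}"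
  proof
    assume reach: "\<forall>u\<in>S. \<forall>v\<in>S. (u, v) \<in> rtrancl_on S ?R"
    show "conn S"
      unfolding conn_def
    proof (intro conjI allI impI that)
      fix A assume A: "A \<noteq> {} \<and> A \<subset> S"
      then obtain u v where uv: "u \<in> A" "v \<in> S" "v \<notin> A" by blast
      with A reach have "(u, v) \<in> rtrancl_on S ?R" by blast
      then show "\<exists>u\<in>A. \<exists>v\<in>S - A. (u, v) \<in> arcs_ends G"
        using uv(3)
      proof (induction rule: rtrancl_on_induct)
        case base
        then show ?case using uv(1) by simp
      next
        case (step y y')
        then show ?case using R by blast
      qed
    qed
  next
    assume S: "conn S"
    show "\<forall>u\<in>S. \<forall>v\<in>S. (u, v) \<in> rtrancl_on S ?R"
    proof (intro ballI)
      fix u v assume uv: "u \<in> S" "v \<in> S"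
      define A where "A = {w \<in> S. (u, w) \<in> rtrancl_on S ?R}"
      have "A = S"
      proof (rule ccontr)
        assume "A \<noteq> S"
        then have "A \<noteq> {}" "A \<subset> S" using uv by (auto simp: A_def)
        with S obtain p r where "p \<in> A" "r \<in> S - A" "(p, r) \<in> arcs_ends G" by (rule conn_crossing)
        then have "(u, r) \<in> rtrancl_on S ?R"
          using R by (auto simp: A_def intro: rtrancl_on_into_rtrancl_on)
        then show False using \<open>r \<in> S - A\<close> by (auto simp: A_def)
      qed
      then show "(u, v) \<in> rtrancl_on S ?R" using uv by (auto simp: A_def)
    qed
  qed
  then show ?thesis
    using conn_nonempty by (auto simp: connected_set_def connected_conv)
qed

theorem corollary1p2:
  fixes G :: "('v, 'e) pre_digraph" and n :: nat and v :: 'v and \<omega> :: "'v \<Rightarrow> real"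
  assumes "Digraph.graph G"
    and "card (verts G) = n"
    and "v \<in> verts G"
    and "\<And>u. u \<in> verts G \<Longrightarrow> 0 \<le> \<omega> u"
  shows "opt_length G v \<omega> \<le> enat (L_seq n)"
proof -
  interpret graph G by fact
  interpret symmetric_relation "\<lambda>u v. (u, v) \<in> arcs_ends G"
    using sym_arcs by unfold_locales (simp add: symmetric_def sym_def)
  define V where "V = verts G"
  have fin: "finite V" by (simp add: V_def)
  have strategy: "strategy G \<sigma> \<longleftrightarrow> set \<sigma> \<subseteq> moves V" for \<sigma>
    using connected_set_iff_conn[OF assms(1)] by (auto simp: strategy_def moves_def V_def)
  have short: "short_strategies V (L_seq n)"
    using short_strategies_L_seq[of V] assms(2,3) fin by (auto simp: V_def)
  \<comment> \<open>With this \<open>x\<close> the bilinear value is the weight that the target receives.\<close>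
  define x where "x = (\<lambda>u. if u = v then 1 else 0 :: real)"
  have val: "ip V x z = z v" for z
    using assms(3) fin by (simp add: ip_def x_def V_def if_distrib[of "\<lambda>t. t * _"] cong: if_cong)
  define T where "T = {\<sigma>. strategy G \<sigma> \<and> length \<sigma> \<le> L_seq n}"
  define f where "f \<sigma> = strategy_op \<sigma> \<omega> v" for \<sigma>
  have "finite {\<sigma>. set \<sigma> \<subseteq> Pow V \<and> length \<sigma> \<le> L_seq n}"
    using fin by (intro finite_lists_length_le) simp
  moreover have "T \<subseteq> {\<sigma>. set \<sigma> \<subseteq> Pow V \<and> length \<sigma> \<le> L_seq n}"
    by (auto simp: T_def strategy moves_def)
  ultimately have finT: "finite T" by (rule finite_subset[rotated])
  have "[] \<in> T" by (simp add: T_def strategy_def)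
  then have "Max (f ` T) \<in> f ` T" using finT by (intro Max_in) auto
  then obtain \<sigma> where \<sigma>: "\<sigma> \<in> T" "f \<sigma> = Max (f ` T)" by auto
  have "f \<tau> \<le> f \<sigma>" if \<tau>: "strategy G \<tau>" for \<tau>
  proof -
    obtain \<tau>' where "set \<tau>' \<subseteq> moves V" "length \<tau>' \<le> L_seq n"
      "ip V x (strategy_op \<tau> \<omega>) \<le> ip V x (strategy_op \<tau>' \<omega>)"
      using short \<tau>[unfolded strategy] by (rule short_strategiesD)
    then have "\<tau>' \<in> T" "f \<tau> \<le> f \<tau>'" by (simp_all add: T_def strategy f_def val)
    then show ?thesis using finT unfolding \<sigma>(2) by (meson Max_ge finite_imageI image_eqI order_trans)
  qed
  then have "(SUP \<tau>\<in>{\<tau>. strategy G \<tau>}. f \<tau>) = f \<sigma>"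
    using \<sigma>(1) by (intro cSup_eq_maximum) (auto simp: T_def)
  then have "optimal_strategy G v \<omega> \<sigma>"
    using \<sigma>(1) by (simp add: optimal_strategy_def f_def T_def)
  then have "opt_length G v \<omega> \<le> enat (length \<sigma>)"
    unfolding opt_length_def by (intro INF_lower) simp
  also have "\<dots> \<le> enat (L_seq n)" using \<sigma>(1) by (simp add: T_def)
  finally show ?thesis .
qed

end
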